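(* Let $K$ be a finite locally oriented simplicial complex, let $\mathscr{C}$ be a cosheaf of finite dimensional $\mathbb{F}$-vector spaces on $K$, let $L,M\subseteq K$ be subcomplexes with $K=L\cup M$, and write $I=L\cap M$. Let $\Sigma$ be an acyclic partial matching on $K$ which is $\mathscr{C}$-compatible and compatible with both subcomplexes $L$ and $M$. For $N\in\{I,L,M,K\}$ let $\mathscr{M}^{N}_{\bullet}:=C^{\Sigma_N}_{\bullet}(N;\mathscr{C}|_N)$ be the Morse chain complex of $\mathscr{C}|_N$ with respect to the restricted matching $\Sigma_N$. Then there is a short exact sequence of chain complexes (the Morse Mayer-Vietoris sequence) $$0\longrightarrow\mathscr{M}_{\bullet}^{I}\longrightarrow\mathscr{M}_{\bullet}^{L}\oplus\mathscr{M}_{\bullet}^{M}\longrightarrow\mathscr{M}_{\bullet}^{K}\longrightarrow 0$$ which is quasi-isomorphic to the Mayer-Vietoris short exact sequence $$0\longrightarrow C_{\bullet}(I;\mathscr{C}|_{I})\overset{p_\bullet}{\longrightarrow}C_{\bullet}(L;\mathscr{C}|_{L})\oplus C_{\bullet}(M;\mathscr{C}|_{M})\overset{q_\bullet}{\longrightarrow}C_{\bullet}(K;\mathscr{C})\longrightarrow 0.$$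
   Context: $\mathbb{F}$ is a field. A finite simplicial complex $K$ (simplices are nonempty) is regarded as a poset under the face relation $\leq$; $K_k$ is its set of $k$-dimensional simplices. A local orientation is a total ordering of the vertices of each simplex such that the ordering of each face is the restriction of the ordering of the simplex; subcomplexes carry the restricted orientation. For $\sigma=(v_0,\dots,v_k)$ put $\sigma_{-i}=(v_0,\dots,v_{i-1},v_{i+1},\dots,v_k)$. The incidence symbol is $[\sigma:\tau]=+1$ if $\tau=\sigma_{-i}$ with $i$ even, $-1$ if $\tau=\sigma_{-i}$ with $i$ odd, and $0$ otherwise. A cosheaf on $K$ is a functor $\mathscr{C}:(K,\leq)^{\mathrm{op}}\to\mathsf{Vect}^{\mathrm{fd}}_{\mathbb{F}}$; write $\mathscr{C}_\sigma=\mathscr{C}(\sigma)$, and $\mathscr{C}_{\sigma\geq\tau}:\mathscr{C}_\sigma\to\mathscr{C}_\tau$ for the map associated to $\tau\leq\sigma$. For a subcomplex $N\subseteq K$, $\mathscr{C}|_N$ is the restriction of the functor $\mathscr{C}$ to $(N,\leq)^{\mathrm{op}}$. The chain complex $C_\bullet(K;\mathscr{C})$ has $C_k(K;\mathscr{C})=\bigoplus_{\sigma\in K_k}\mathscr{C}_\sigma$, and the block $\mathscr{C}_\sigma\to\mathscr{C}_\tau$ of $\partial_k$ is $[\sigma:\tau]\cdot\mathscr{C}_{\sigma\geq\tau}$ (zero if $[\sigma:\tau]=0$). In the Mayer-Vietoris sequence, subcomplex inclusions $A\subseteq B$ induce inclusions $C_\bullet(A;\mathscr{C}|_A)\hookrightarrow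 C_\bullet(B;\mathscr{C}|_B)$ of direct summands in each degree; $p_\bullet$ has as its two components the inclusions induced by $I\subseteq L$ and $I\subseteq M$, and $q_\bullet(x,y)=i'(x)-j'(y)$ where $i',j'$ are the inclusions induced by $L\subseteq K$, $M\subseteq K$. Write $\sigma\lhd\tau$ (or $\tau\rhd\sigma$) when $\sigma$ is a codimension one face of $\tau$, and $\mathscr{C}_{\tau\rhd\sigma}$ for $\mathscr{C}_{\tau\geq\sigma}$ in this case. A partial matching on $K$ is a set $\Sigma$ of pairs $(\sigma\lhd\tau)$ of simplices of $K$ such that each simplex appears in at most one pair. A simplex is $\Sigma$-critical if it appears in no pair. A $\Sigma$-path is a zig-zag of distinct simplices $\rho=(\sigma_1\lhd\tau_1\rhd\sigma_2\lhd\tau_2\rhd\cdots\rhd\sigma_m\lhd\tau_m)$, $m\geq1$, with $(\sigma_i\lhd\tau_i)\in\Sigma$ for all $i$. It is gradient if $m=1$ or $\sigma_1$ is not a face of $\tau_m$. $\Sigma$ is acyclic if all its paths are gradient. An acyclic partial matching is $\mathscr{C}$-compatible if $\mathscr{C}_{\tau\rhd\sigma}$ is an isomorphism for every $(\sigma\lhd\tau)\in\Sigma$. It is compatible with a subcomplex $N\subseteq K$ if for every $(\sigma\lhd\tau)\in\Sigma$ one has $\sigma\in N$ if and only if $\tau\in N$; in general $\Sigma_N:=\{(\sigma\lhd\tau)\in\Sigma\mid\sigma,\tau\in N\}$ (so $\Sigma_K=\Sigma$). For a $\mathscr{C}$-compatible acyclic $\Sigma$ and a $\Sigma$-path $\rho=(\sigma_1\lhd\tau_1\rhd\sigma_2\lhd\tau_2\rhd\cdots\rhd\sigma_m\lhd\tau_m)$,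 its weight is the linear map $\mathscr{C}_{\sigma_1}\to\mathscr{C}_{\tau_m}$ $$\omega_\rho^{\mathscr{C}}=\varepsilon_\rho\cdot\mathscr{C}^{-1}_{\tau_m\rhd\sigma_m}\circ\mathscr{C}_{\tau_{m-1}\rhd\sigma_m}\circ\cdots\circ\mathscr{C}^{-1}_{\tau_2\rhd\sigma_2}\circ\mathscr{C}_{\tau_1\rhd\sigma_2}\circ\mathscr{C}^{-1}_{\tau_1\rhd\sigma_1},$$ with $\varepsilon_\rho=(-1)^m[\tau_m:\sigma_m][\tau_{m-1}:\sigma_m]\cdots[\tau_2:\sigma_2][\tau_1:\sigma_2][\tau_1:\sigma_1]$. The Morse chain complex $C^\Sigma_\bullet(K;\mathscr{C})$ has $C^\Sigma_k(K;\mathscr{C})=\bigoplus_\alpha\mathscr{C}_\alpha$ over $\Sigma$-critical $\alpha\in K_k$, and the block $\mathscr{C}_\alpha\to\mathscr{C}_\omega$ of its boundary map (critical $\alpha\in K_k$, $\omega\in K_{k-1}$) is $$[\alpha:\omega]\cdot\mathscr{C}_{\alpha\rhd\omega}+\sum_{\rho=(\sigma\lhd\cdots\lhd\tau)}[\tau:\omega]\,[\alpha:\sigma]\cdot\mathscr{C}_{\tau\rhd\omega}\circ\omega^{\mathscr{C}}_\rho\circ\mathscr{C}_{\alpha\rhd\sigma},$$ the sum running over all $\Sigma$-paths $\rho$ (with first simplex $\sigma$ and last simplex $\tau$), terms with a vanishing incidence symbol being zero. Two short exact sequences of chain complexes are quasi-isomorphic here if there is a morphism of short exact sequences (a commutative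 ladder of chain maps) from one of them to the other whose three vertical maps are quasi-isomorphisms. *)

theory Defs
  imports Complex_Main "HOL-Library.Function_Algebras" "HOL-Library.Product_Plus"
begin

subsection \<open>Chain complexes of vector spaces\<close>

text \<open>
  Complexes are graded by the integers. All chain groups of one complex are subspaces of a single
  ambient vector space whose scalar multiplication is \<open>scl\<close>;
  \<open>bdry C k\<close> goes from degree \<open>k\<close> to degree \<open>k - 1\<close>.
  Only the values of maps on the chain groups are meaningful.
\<close>

record ('f, 'x) cpx =
  scl :: "'f \<Rightarrow> 'x \<Rightarrow> 'x"
  chains :: "int \<Rightarrow> 'x set"
  bdry :: "int \<Rightarrow> 'x \<Rightarrow> 'x"

definition linear_on ::
  "('f::field \<Rightarrow> 'x::ab_group_add \<Rightarrow> 'x) \<Rightarrow> ('f \<Rightarrow> 'y::ab_group_add \<Rightarrow> 'y) \<Rightarrow>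
   'x set \<Rightarrow> 'y set \<Rightarrow> ('x \<Rightarrow> 'y) \<Rightarrow> bool" where
  "linear_on s t S T f \<longleftrightarrow>
     (\<forall>x\<in>S. f x \<in> T) \<and>
     (\<forall>x\<in>S. \<forall>y\<in>S. f (x + y) = f x + f y) \<and>
     (\<forall>c. \<forall>x\<in>S. f (s c x) = t c (f x))"

definition chain_complex :: "('f::field, 'x::ab_group_add) cpx \<Rightarrow> bool" where
  "chain_complex C \<longleftrightarrow>
     vector_space (scl C) \<and>
     (\<forall>k. module.subspace (scl C) (chains C k)) \<and>
     (\<forall>k. linear_on (scl C) (scl C) (chains C k) (chains C (k - 1)) (bdry C k)) \<and>
     (\<forall>k. \<forall>x\<in>chains C k. bdry C (k - 1) (bdry C k x) = 0)"

definition chain_map ::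
  "('f::field, 'x::ab_group_add) cpx \<Rightarrow> ('f, 'y::ab_group_add) cpx \<Rightarrow>
   (int \<Rightarrow> 'x \<Rightarrow> 'y) \<Rightarrow> bool" where
  "chain_map C D f \<longleftrightarrow>
     (\<forall>k. linear_on (scl C) (scl D) (chains C k) (chains D k) (f k)) \<and>
     (\<forall>k. \<forall>x\<in>chains C k. bdry D k (f k x) = f (k - 1) (bdry C k x))"

definition cycles :: "('f, 'x::ab_group_add) cpx \<Rightarrow> int \<Rightarrow> 'x set" where
  "cycles C k = {x \<in> chains C k. bdry C k x = 0}"

definition boundaries :: "('f, 'x::ab_group_add) cpx \<Rightarrow> int \<Rightarrow> 'x set" where
  "boundaries C k = bdry C (k + 1) ` chains C (k + 1)"

definition homologous :: "('f, 'x::ab_group_add) cpx \<Rightarrow> int \<Rightarrow> ('x \<times> 'x) set" where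
  "homologous C k = {(x, y). x \<in> cycles C k \<and> y \<in> cycles C k \<and> x - y \<in> boundaries C k}"

definition homology :: "('f, 'x::ab_group_add) cpx \<Rightarrow> int \<Rightarrow> 'x set set" where
  "homology C k = cycles C k // homologous C k"

text \<open>The map induced in homology sends the class \<open>X\<close> to the class containing \<open>f k ` X\<close>.\<close>

definition homology_map ::
  "('f, 'y::ab_group_add) cpx \<Rightarrow> (int \<Rightarrow> 'x \<Rightarrow> 'y) \<Rightarrow> int \<Rightarrow> 'x set \<Rightarrow> 'y set" where
  "homology_map D f k X = homologous D k `` (f k ` X)"

text \<open>
  The map induced by a chain map is automatically linear, so it is an isomorphism as soon as
  it is bijective.
\<close>

definition quasi_isomorphism ::
  "('f::field, 'x::ab_group_add) cpx \<Rightarrow> ('f, 'y::ab_group_add) cpx \<Rightarrow>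
   (int \<Rightarrow> 'x \<Rightarrow> 'y) \<Rightarrow> bool" where
  "quasi_isomorphism C D f \<longleftrightarrow>
     chain_map C D f \<and>
     (\<forall>k. bij_betw (homology_map D f k) (homology C k) (homology D k))"

definition cpx_sum ::
  "('f, 'x) cpx \<Rightarrow> ('f, 'y) cpx \<Rightarrow> ('f, 'x \<times> 'y) cpx" (infixr "\<oplus>\<^sub>c" 65) where
  "C \<oplus>\<^sub>c D =
     \<lparr> scl = (\<lambda>c (x, y). (scl C c x, scl D c y)),
       chains = (\<lambda>k. chains C k \<times> chains D k),
       bdry = (\<lambda>k (x, y). (bdry C k x, bdry D k y)) \<rparr>"


subsection \<open>Short exact sequences of chain complexes\<close>

record ('f, 'x, 'y, 'z) cpx_seq =
  lcpx :: "('f, 'x) cpx"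
  lmap :: "int \<Rightarrow> 'x \<Rightarrow> 'y"
  mcpx :: "('f, 'y) cpx"
  rmap :: "int \<Rightarrow> 'y \<Rightarrow> 'z"
  rcpx :: "('f, 'z) cpx"

definition short_exact ::
  "('f::field, 'x::ab_group_add, 'y::ab_group_add, 'z::ab_group_add) cpx_seq \<Rightarrow> bool" where
  "short_exact S \<longleftrightarrow>
     chain_complex (lcpx S) \<and> chain_complex (mcpx S) \<and> chain_complex (rcpx S) \<and>
     chain_map (lcpx S) (mcpx S) (lmap S) \<and> chain_map (mcpx S) (rcpx S) (rmap S) \<and>
     (\<forall>k. inj_on (lmap S k) (chains (lcpx S) k) \<and>
          lmap S k ` chains (lcpx S) k = {y \<in> chains (mcpx S) k. rmap S k y = 0} \<and>
          rmap S k ` chains (mcpx S) k = chains (rcpx S) k)"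

text \<open>
  A commutative ladder of chain maps whose three vertical maps are quasi-isomorphisms.
\<close>

definition quasi_iso_ladder ::
  "('f::field, 'x::ab_group_add, 'y::ab_group_add, 'z::ab_group_add) cpx_seq \<Rightarrow>
   ('f, 'x'::ab_group_add, 'y'::ab_group_add, 'z'::ab_group_add) cpx_seq \<Rightarrow>
   (int \<Rightarrow> 'x \<Rightarrow> 'x') \<Rightarrow> (int \<Rightarrow> 'y \<Rightarrow> 'y') \<Rightarrow> (int \<Rightarrow> 'z \<Rightarrow> 'z') \<Rightarrow> bool" where
  "quasi_iso_ladder S T f g h \<longleftrightarrow>
     quasi_isomorphism (lcpx S) (lcpx T) f \<and>
     quasi_isomorphism (mcpx S) (mcpx T) g \<and>
     quasi_isomorphism (rcpx S) (rcpx T) h \<and>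
     (\<forall>k. \<forall>x\<in>chains (lcpx S) k. g k (lmap S k x) = lmap T k (f k x)) \<and>
     (\<forall>k. \<forall>y\<in>chains (mcpx S) k. h k (rmap S k y) = rmap T k (g k y))"

definition quasi_isomorphic_ses ::
  "('f::field, 'x::ab_group_add, 'y::ab_group_add, 'z::ab_group_add) cpx_seq \<Rightarrow>
   ('f, 'x'::ab_group_add, 'y'::ab_group_add, 'z'::ab_group_add) cpx_seq \<Rightarrow> bool" where
  "quasi_isomorphic_ses S T \<longleftrightarrow>
     short_exact S \<and> short_exact T \<and>
     ((\<exists>f g h. quasi_iso_ladder S T f g h) \<or> (\<exists>f g h. quasi_iso_ladder T S f g h))"


subsection \<open>Locally oriented simplicial complexes\<close>

definition simplicial_complex :: "'a set set \<Rightarrow> bool" where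
  "simplicial_complex K \<longleftrightarrow>
     finite K \<and>
     (\<forall>\<sigma>\<in>K. finite \<sigma> \<and> \<sigma> \<noteq> {} \<and> (\<forall>\<tau>. \<tau> \<subseteq> \<sigma> \<and> \<tau> \<noteq> {} \<longrightarrow> \<tau> \<in> K))"

definition subcomplex :: "'a set set \<Rightarrow> 'a set set \<Rightarrow> bool" where
  "subcomplex N K \<longleftrightarrow> simplicial_complex N \<and> N \<subseteq> K"

definition simplices :: "'a set set \<Rightarrow> int \<Rightarrow> 'a set set" where
  "simplices K k = {\<sigma> \<in> K. int (card \<sigma>) = k + 1}"

definition codim_one_face :: "'a set \<Rightarrow> 'a set \<Rightarrow> bool" (infix "\<lhd>\<^sub>1" 50) where
  "\<sigma> \<lhd>\<^sub>1 \<tau> \<longleftrightarrow> \<sigma> \<subseteq> \<tau> \<and> card \<tau> = Suc (card \<sigma>)"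

text \<open>
  A total ordering of the vertices of \<open>\<sigma>\<close> is given by the increasing list
  \<open>ori \<sigma> = [v\<^sub>0, \<dots>, v\<^sub>k]\<close>. A subcomplex carries the same function \<open>ori\<close>.
\<close>

definition local_orientation :: "'a set set \<Rightarrow> ('a set \<Rightarrow> 'a list) \<Rightarrow> bool" where
  "local_orientation K ori \<longleftrightarrow>
     (\<forall>\<sigma>\<in>K. distinct (ori \<sigma>) \<and> set (ori \<sigma>) = \<sigma>) \<and>
     (\<forall>\<sigma>\<in>K. \<forall>\<tau>\<in>K. \<tau> \<subseteq> \<sigma> \<longrightarrow> ori \<tau> = filter (\<lambda>v. v \<in> \<tau>) (ori \<sigma>))"

definition omit :: "nat \<Rightarrow> 'a list \<Rightarrow> 'a list" where
  "omit i vs = take i vs @ drop (Suc i) vs"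

definition incidence :: "('a set \<Rightarrow> 'a list) \<Rightarrow> 'a set \<Rightarrow> 'a set \<Rightarrow> int" where
  "incidence ori \<sigma> \<tau> =
     (if \<exists>i<length (ori \<sigma>). even i \<and> ori \<tau> = omit i (ori \<sigma>) then 1
      else if \<exists>i<length (ori \<sigma>). odd i \<and> ori \<tau> = omit i (ori \<sigma>) then - 1
      else 0)"


subsection \<open>Cosheaves and their chain complexes\<close>

text \<open>
  The stalks are finite dimensional subspaces of one ambient vector space with scalar
  multiplication \<open>vscale\<close>, which need not be finite dimensional itself. No relation between
  different stalks is imposed: up to isomorphism any family of finite dimensional vector spaces
  arises in this way, e.g. inside its direct sum. \<open>ext C \<sigma> \<tau>\<close> is the map from the stalk at
  \<open>\<sigma>\<close> to the stalk at the face \<open>\<tau>\<close> of \<open>\<sigma>\<close>.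
  Since all constructions below read a cosheaf only at simplices of the complex they are given,
  the restriction of a cosheaf to a subcomplex is represented by the same record.
\<close>

record ('f, 'a, 'v) cosheaf_data =
  vscale :: "'f \<Rightarrow> 'v \<Rightarrow> 'v"
  stalk :: "'a set \<Rightarrow> 'v set"
  ext :: "'a set \<Rightarrow> 'a set \<Rightarrow> 'v \<Rightarrow> 'v"

definition cosheaf :: "'a set set \<Rightarrow> ('f::field, 'a, 'v::ab_group_add) cosheaf_data \<Rightarrow> bool" where
  "cosheaf K C \<longleftrightarrow>
     vector_space (vscale C) \<and>
     (\<forall>\<sigma>\<in>K. module.subspace (vscale C) (stalk C \<sigma>) \<and>
            (\<exists>B. finite B \<and> module.span (vscale C) B = stalk C \<sigma>)) \<and>
     (\<forall>\<sigma>\<in>K. \<forall>\<tau>\<in>K. \<tau> \<subseteq> \<sigma> \<longrightarrow>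
        linear_on (vscale C) (vscale C) (stalk C \<sigma>) (stalk C \<tau>) (ext C \<sigma> \<tau>)) \<and>
     (\<forall>\<sigma>\<in>K. \<forall>x\<in>stalk C \<sigma>. ext C \<sigma> \<sigma> x = x) \<and>
     (\<forall>\<sigma>\<in>K. \<forall>\<tau>\<in>K. \<forall>\<upsilon>\<in>K. \<upsilon> \<subseteq> \<tau> \<and> \<tau> \<subseteq> \<sigma> \<longrightarrow>
        (\<forall>x\<in>stalk C \<sigma>. ext C \<tau> \<upsilon> (ext C \<sigma> \<tau> x) = ext C \<sigma> \<upsilon> x))"

text \<open>
  The direct sum of the stalks over a (finite) set \<open>X\<close> of simplices, as families vanishing
  outside \<open>X\<close>, and the map between two such sums with blocks \<open>b \<sigma> \<tau>\<close>.
\<close>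

definition stalk_sum ::
  "('f, 'a, 'v::ab_group_add) cosheaf_data \<Rightarrow> 'a set set \<Rightarrow> ('a set \<Rightarrow> 'v) set" where
  "stalk_sum C X = {x. (\<forall>\<sigma>\<in>X. x \<sigma> \<in> stalk C \<sigma>) \<and> (\<forall>\<sigma>. \<sigma> \<notin> X \<longrightarrow> x \<sigma> = 0)}"

definition block_map ::
  "'a set set \<Rightarrow> 'a set set \<Rightarrow> ('a set \<Rightarrow> 'a set \<Rightarrow> 'v \<Rightarrow> 'v::ab_group_add) \<Rightarrow>
   ('a set \<Rightarrow> 'v) \<Rightarrow> ('a set \<Rightarrow> 'v)" where
  "block_map X Y b x = (\<lambda>\<tau>. if \<tau> \<in> Y then \<Sum>\<sigma>\<in>X. b \<sigma> \<tau> (x \<sigma>) else 0)"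

definition simplicial_chains ::
  "('a set \<Rightarrow> 'a list) \<Rightarrow> 'a set set \<Rightarrow> ('f::field, 'a, 'v::ab_group_add) cosheaf_data \<Rightarrow>
   ('f, 'a set \<Rightarrow> 'v) cpx" where
  "simplicial_chains ori K C =
     \<lparr> scl = (\<lambda>c x \<sigma>. vscale C c (x \<sigma>)),
       chains = (\<lambda>k. stalk_sum C (simplices K k)),
       bdry = (\<lambda>k. block_map (simplices K k) (simplices K (k - 1))
         (\<lambda>\<sigma> \<tau> v. vscale C (of_int (incidence ori \<sigma> \<tau>)) (ext C \<sigma> \<tau> v))) \<rparr>"

text \<open>
  As chains are families extended by zero, the inclusion of the chains of a subcomplex is the
  identity on the underlying families.
\<close>

definition mayer_vietoris ::
  "('a set \<Rightarrow> 'a list) \<Rightarrow> 'a set set \<Rightarrow> 'a set set \<Rightarrow>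
   ('f::field, 'a, 'v::ab_group_add) cosheaf_data \<Rightarrow>
   ('f, 'a set \<Rightarrow> 'v, ('a set \<Rightarrow> 'v) \<times> ('a set \<Rightarrow> 'v), 'a set \<Rightarrow> 'v) cpx_seq" where
  "mayer_vietoris ori L M C =
     \<lparr> lcpx = simplicial_chains ori (L \<inter> M) C,
       lmap = (\<lambda>k x. (x, x)),
       mcpx = simplicial_chains ori L C \<oplus>\<^sub>c simplicial_chains ori M C,
       rmap = (\<lambda>k (x, y). x - y),
       rcpx = simplicial_chains ori (L \<union> M) C \<rparr>"


subsection \<open>Acyclic partial matchings\<close>

definition partial_matching :: "'a set set \<Rightarrow> ('a set \<times> 'a set) set \<Rightarrow> bool" where
  "partial_matching K \<Sigma> \<longleftrightarrow>
     (\<forall>(\<sigma>, \<tau>)\<in>\<Sigma>. \<sigma> \<in> K \<and> \<tau> \<in> K \<and> \<sigma> \<lhd>\<^sub>1 \<tau>) \<and>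
     (\<forall>p\<in>\<Sigma>. \<forall>q\<in>\<Sigma>. p \<noteq> q \<longrightarrow> {fst p, snd p} \<inter> {fst q, snd q} = {})"

definition critical :: "'a set set \<Rightarrow> ('a set \<times> 'a set) set \<Rightarrow> 'a set set" where
  "critical K \<Sigma> = {\<alpha> \<in> K. \<forall>(\<sigma>, \<tau>)\<in>\<Sigma>. \<alpha> \<noteq> \<sigma> \<and> \<alpha> \<noteq> \<tau>}"

text \<open>
  The path \<open>\<sigma>\<^sub>1 \<lhd> \<tau>\<^sub>1 \<rhd> \<sigma>\<^sub>2 \<lhd> \<dots> \<rhd> \<sigma>\<^sub>m \<lhd> \<tau>\<^sub>m\<close> is the list
  \<open>[(\<sigma>\<^sub>1, \<tau>\<^sub>1), \<dots>, (\<sigma>\<^sub>m, \<tau>\<^sub>m)]\<close>.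
\<close>

definition matching_paths :: "('a set \<times> 'a set) set \<Rightarrow> ('a set \<times> 'a set) list set" where
  "matching_paths \<Sigma> =
     {\<rho>. \<rho> \<noteq> [] \<and> set \<rho> \<subseteq> \<Sigma> \<and> distinct (map fst \<rho> @ map snd \<rho>) \<and>
         (\<forall>i. Suc i < length \<rho> \<longrightarrow> fst (\<rho> ! Suc i) \<lhd>\<^sub>1 snd (\<rho> ! i))}"

definition gradient_path :: "('a set \<times> 'a set) list \<Rightarrow> bool" where
  "gradient_path \<rho> \<longleftrightarrow> length \<rho> = 1 \<or> \<not> fst (hd \<rho>) \<subseteq> snd (last \<rho>)"

definition acyclic_matching :: "'a set set \<Rightarrow> ('a set \<times> 'a set) set \<Rightarrow> bool" where
  "acyclic_matching K \<Sigma> \<longleftrightarrow>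
     partial_matching K \<Sigma> \<and> (\<forall>\<rho>\<in>matching_paths \<Sigma>. gradient_path \<rho>)"

definition cosheaf_compatible ::
  "('f, 'a, 'v) cosheaf_data \<Rightarrow> ('a set \<times> 'a set) set \<Rightarrow> bool" where
  "cosheaf_compatible C \<Sigma> \<longleftrightarrow> (\<forall>(\<sigma>, \<tau>)\<in>\<Sigma>. bij_betw (ext C \<tau> \<sigma>) (stalk C \<tau>) (stalk C \<sigma>))"

definition subcomplex_compatible :: "'a set set \<Rightarrow> ('a set \<times> 'a set) set \<Rightarrow> bool" where
  "subcomplex_compatible N \<Sigma> \<longleftrightarrow> (\<forall>(\<sigma>, \<tau>)\<in>\<Sigma>. \<sigma> \<in> N \<longleftrightarrow> \<tau> \<in> N)"

definition restrict_matching ::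
  "('a set \<times> 'a set) set \<Rightarrow> 'a set set \<Rightarrow> ('a set \<times> 'a set) set" where
  "restrict_matching \<Sigma> N = {(\<sigma>, \<tau>) \<in> \<Sigma>. \<sigma> \<in> N \<and> \<tau> \<in> N}"


subsection \<open>The Morse chain complex\<close>

definition path_sign :: "('a set \<Rightarrow> 'a list) \<Rightarrow> ('a set \<times> 'a set) list \<Rightarrow> int" where
  "path_sign ori \<rho> =
     (- 1) ^ length \<rho> *
     (\<Prod>i<length \<rho>. incidence ori (snd (\<rho> ! i)) (fst (\<rho> ! i))) *
     (\<Prod>i<length \<rho> - 1. incidence ori (snd (\<rho> ! i)) (fst (\<rho> ! Suc i)))"

definition stalk_inv ::
  "('f, 'a, 'v) cosheaf_data \<Rightarrow> 'a set \<Rightarrow> 'a set \<Rightarrow> 'v \<Rightarrow> 'v" where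
  "stalk_inv C \<tau> \<sigma> = inv_into (stalk C \<tau>) (ext C \<tau> \<sigma>)"

fun zigzag_map ::
  "('f, 'a, 'v) cosheaf_data \<Rightarrow> ('a set \<times> 'a set) list \<Rightarrow> 'v \<Rightarrow> 'v" where
  "zigzag_map C [] = id"
| "zigzag_map C [(\<sigma>, \<tau>)] = stalk_inv C \<tau> \<sigma>"
| "zigzag_map C ((\<sigma>, \<tau>) # (\<sigma>', \<tau>') # \<rho>) =
     zigzag_map C ((\<sigma>', \<tau>') # \<rho>) \<circ> ext C \<tau> \<sigma>' \<circ> stalk_inv C \<tau> \<sigma>"

definition path_weight ::
  "('a set \<Rightarrow> 'a list) \<Rightarrow> ('f::field, 'a, 'v) cosheaf_data \<Rightarrow> ('a set \<times> 'a set) list \<Rightarrow>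
   'v \<Rightarrow> 'v" where
  "path_weight ori C \<rho> v = vscale C (of_int (path_sign ori \<rho>)) (zigzag_map C \<rho> v)"

text \<open>
  In the following formula a term whose incidence coefficient is zero vanishes, as
  \<open>vscale C 0 v = 0\<close> for every \<open>v\<close>.
\<close>

definition morse_block ::
  "('a set \<Rightarrow> 'a list) \<Rightarrow> ('f::field, 'a, 'v::ab_group_add) cosheaf_data \<Rightarrow>
   ('a set \<times> 'a set) set \<Rightarrow> 'a set \<Rightarrow> 'a set \<Rightarrow> 'v \<Rightarrow> 'v" where
  "morse_block ori C \<Sigma> \<alpha> \<omega> v =
     vscale C (of_int (incidence ori \<alpha> \<omega>)) (ext C \<alpha> \<omega> v) +
     (\<Sum>\<rho>\<in>matching_paths \<Sigma>.
        vscale C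
          (of_int (incidence ori (snd (last \<rho>)) \<omega> * incidence ori \<alpha> (fst (hd \<rho>))))
          (ext C (snd (last \<rho>)) \<omega> (path_weight ori C \<rho> (ext C \<alpha> (fst (hd \<rho>)) v))))"

definition morse_complex ::
  "('a set \<Rightarrow> 'a list) \<Rightarrow> 'a set set \<Rightarrow> ('f::field, 'a, 'v::ab_group_add) cosheaf_data \<Rightarrow>
   ('a set \<times> 'a set) set \<Rightarrow> ('f, 'a set \<Rightarrow> 'v) cpx" where
  "morse_complex ori K C \<Sigma> =
     \<lparr> scl = (\<lambda>c x \<sigma>. vscale C c (x \<sigma>)),
       chains = (\<lambda>k. stalk_sum C (critical K \<Sigma> \<inter> simplices K k)),
       bdry = (\<lambda>k. block_map (critical K \<Sigma> \<inter> simplices K k)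
                             (critical K \<Sigma> \<inter> simplices K (k - 1))
                             (morse_block ori C \<Sigma>)) \<rparr>"

end

theory Submission
  imports Defs
begin

text \<open>
  The simplices fall into three classes: critical ones, sources (first components of pairs of
  \<open>\<Sigma>\<close>) and targets (second components). The block of the simplicial boundary map from targets to
  sources is invertible. Along the matching its entries are isomorphisms, and the remaining
  entries step from one pair to another, which acyclicity allows only finitely often. Summing the
  weights of all \<open>\<Sigma>\<close>-paths gives minus the inverse of this block (\<open>boundary_flow_source\<close>,
  \<open>target_chain_eq_zero\<close>), so the Morse boundary map is the Schur complement of the block.

  Call a chain reduced if neither it nor its boundary has a component at a source. Reduced chains
  form a subcomplex, and a reduced chain is determined by its components at critical simplices
  (\<open>reduced_eqI\<close>): the difference of two reduced chains with the same critical part is a chain on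
  targets whose boundary vanishes on sources. Conversely \<open>x + flow (\<partial> x)\<close> is a reduced extension
  of a critical chain \<open>x\<close>, and the Morse boundary of \<open>x\<close> is the critical part of the boundary of
  this extension (\<open>morse_boundary\<close>). So the Morse complex is a copy of the complex of reduced
  chains. Since the components of any chain at the sources can be removed by adding a boundary,
  the inclusion of the reduced chains is a quasi-isomorphism (\<open>quasi_isomorphism_embed\<close>).

  If a subcomplex is compatible with the matching, its reduced chains are reduced in the whole
  complex, and uniqueness of reduced extensions shows that the embedding of its Morse complex is
  the restriction of the embedding of the whole one (\<open>embed_restrict\<close>). Hence these embeddings
  commute with the diagonal \<open>x \<mapsto> (x, x)\<close> and the difference \<open>(x, y) \<mapsto> x - y\<close>, and they form a
  ladder from the Morse sequence to the Mayer-Vietoris sequence. Both sequences are exact for the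
  same reason (\<open>short_exact_stalk_sums\<close>): they consist of direct sums of stalks over sets of
  simplices of the form \<open>X \<inter> Y\<close>, \<open>X\<close>, \<open>Y\<close> and \<open>X \<union> Y\<close>.
\<close>

section \<open>Linear maps and quasi-isomorphisms\<close>

lemma linear_on_zero:
  assumes "vector_space s" "module.subspace s S" "linear_on s t S T f"
  shows "f 0 = 0"
proof -
  interpret vector_space s by fact
  have "0 \<in> S"
    using assms(2) by (rule subspace_0)
  then have "f (0 + 0) = f 0 + f 0"
    using assms(3) unfolding linear_on_def by blast
  then show ?thesis by simp
qed

lemma linear_on_diff:
  assumes "vector_space s" "vector_space t" "module.subspace s S" "linear_on s t S T f"
    and "x \<in> S" "y \<in> S"
  shows "f (x - y) = f x - f y"
proof -
  interpret s: vector_space s by fact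
  interpret t: vector_space t by fact
  have "x - y \<in> S"
    using assms s.subspace_diff by blast
  then have "f ((x - y) + y) = f (x - y) + f y"
    using assms unfolding linear_on_def by blast
  then show ?thesis by simp
qed

lemma linear_on_sum:
  assumes "vector_space s" "module.subspace s S" "linear_on s t S T f"
    and "\<And>i. i \<in> A \<Longrightarrow> g i \<in> S"
  shows "f (\<Sum>i\<in>A. g i) = (\<Sum>i\<in>A. f (g i))"
proof -
  interpret vector_space s by fact
  show ?thesis
    using assms(4)
  proof (induction A rule: infinite_finite_induct)
    case (insert a A)
    moreover have "(\<Sum>i\<in>A. g i) \<in> S"
      using insert assms(2) by (intro subspace_sum) auto
    ultimately show ?case
      using assms(3) unfolding linear_on_def by simp
  qed (use linear_on_zero[OF assms(1-3)] in auto)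
qed

lemma linear_on_cong:
  assumes "linear_on s t S T f" "module.subspace s S" "vector_space s" "\<And>x. x \<in> S \<Longrightarrow> g x = f x"
  shows "linear_on s t S T g"
proof -
  interpret vector_space s by fact
  show ?thesis
    using assms(1,4) subspace_add[OF assms(2)] subspace_scale[OF assms(2)]
    by (simp add: linear_on_def)
qed

lemma linear_on_comp:
  "linear_on s t S T f \<Longrightarrow> linear_on t u T U g \<Longrightarrow> linear_on s u S U (g \<circ> f)"
  unfolding linear_on_def by simp

lemma linear_on_scale:
  assumes "vector_space t" "module.subspace t T" "linear_on s t S T f"
  shows "linear_on s t S T (\<lambda>x. t c (f x))"
proof -
  interpret vector_space t by fact
  show ?thesis
    using assms(3) subspace_scale[OF assms(2)]
    unfolding linear_on_def by (auto simp: scale_right_distrib mult.commute)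
qed

lemma linear_on_inv_into:
  assumes "vector_space s" "module.subspace s S" "linear_on s t S T f" "bij_betw f S T"
  shows "linear_on t s T S (inv_into S f)"
proof -
  interpret vector_space s by fact
  have mem: "inv_into S f y \<in> S" and inv: "f (inv_into S f y) = y" if "y \<in> T" for y
    using that assms(4) by (auto simp: bij_betw_def inv_into_into f_inv_into_f)
  have eq: "inv_into S f y = x" if "x \<in> S" "f x = y" for x y
    using that assms(4) by (auto simp: bij_betw_def)
  show ?thesis
    unfolding linear_on_def
  proof (intro conjI ballI allI)
    fix x y assume "x \<in> T" "y \<in> T"
    then show "inv_into S f (x + y) = inv_into S f x + inv_into S f y"
      using assms(3) mem inv subspace_add[OF assms(2)] unfolding linear_on_def
      by (intro eq) auto
  next
    fix c x assume "x \<in> T"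
    then show "inv_into S f (t c x) = s c (inv_into S f x)"
      using assms(3) mem inv subspace_scale[OF assms(2)] unfolding linear_on_def
      by (intro eq) auto
  qed (use mem in auto)
qed

lemma vector_space_Pi:
  assumes "vector_space s"
  shows "vector_space (\<lambda>c x i. s c (x i))"
proof -
  interpret vector_space s by fact
  show ?thesis
    by unfold_locales (auto simp: scale_right_distrib scale_left_distrib)
qed

lemma equiv_homologous:
  assumes E: "chain_complex E"
  shows "equiv (cycles E k) (homologous E k)"
proof -
  interpret vector_space "scl E"
    using E by (simp add: chain_complex_def)
  have sub: "module.subspace (scl E) (chains E j)" for j
    using E by (simp add: chain_complex_def)
  have lin: "linear_on (scl E) (scl E) (chains E j) (chains E (j - 1)) (bdry E j)" for j
    using E by (simp add: chain_complex_def)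
  have add: "bdry E j (a + b) = bdry E j a + bdry E j b"
    if "a \<in> chains E j" "b \<in> chains E j" for a b j
    using lin that by (simp add: linear_on_def)
  have diff: "bdry E j (a - b) = bdry E j a - bdry E j b"
    if "a \<in> chains E j" "b \<in> chains E j" for a b j
    using linear_on_diff[OF vector_space_axioms vector_space_axioms sub lin that] .
  have zero: "0 \<in> boundaries E k"
    unfolding boundaries_def
    by (rule image_eqI[of _ _ 0])
      (simp_all add: linear_on_zero[OF vector_space_axioms sub lin] subspace_0[OF sub])
  have badd: "a + b \<in> boundaries E k" if "a \<in> boundaries E k" "b \<in> boundaries E k" for a b
    using that subspace_add[OF sub] unfolding boundaries_def by (auto simp flip: add)
  have bdiff: "a - b \<in> boundaries E k" if "a \<in> boundaries E k" "b \<in> boundaries E k" for a b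
    using that subspace_diff[OF sub] unfolding boundaries_def by (auto simp flip: diff)
  show ?thesis
  proof (rule equivI)
    show "homologous E k \<subseteq> cycles E k \<times> cycles E k" by (auto simp: homologous_def)
    show "refl_on (cycles E k) (homologous E k)"
      using zero by (auto simp: refl_on_def homologous_def)
    show "sym (homologous E k)"
      using bdiff[OF zero, of "x - y" for x y] by (auto simp: sym_def homologous_def)
    show "trans (homologous E k)"
      using badd[of "x - y" "y - z" for x y z]
      by (intro transI) (auto simp: homologous_def)
  qed
qed

text \<open>
  This removes the quotients: injectivity in homology need only be tested against the zero class,
  as the map is additive on cycles, and surjectivity means that every cycle is homologous to the
  image of a cycle.
\<close>

lemma quasi_isomorphism_iff:
  assumes C: "chain_complex C" and D: "chain_complex D" and f: "chain_map C D f"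
  shows "quasi_isomorphism C D f \<longleftrightarrow>
    (\<forall>k. (\<forall>x\<in>cycles C k. f k x \<in> boundaries D k \<longrightarrow> x \<in> boundaries C k) \<and>
         (\<forall>z\<in>cycles D k. \<exists>x\<in>cycles C k. f k x - z \<in> boundaries D k))"
proof -
  interpret c: vector_space "scl C" using C by (simp add: chain_complex_def)
  interpret d: vector_space "scl D" using D by (simp add: chain_complex_def)
  have sub: "module.subspace (scl C) (chains C j)" for j
    using C by (simp add: chain_complex_def)
  have lin: "linear_on (scl C) (scl D) (chains C j) (chains D j) (f j)" for j
    using f by (simp add: chain_map_def)
  have linb: "linear_on (scl C) (scl C) (chains C j) (chains C (j - 1)) (bdry C j)" for j
    using C by (simp add: chain_complex_def)
  note bdiff = linear_on_diff[OF c.vector_space_axioms c.vector_space_axioms sub linb]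
  note f_zero = linear_on_zero[OF c.vector_space_axioms sub lin]
  have fcyc: "f j x \<in> cycles D j" if "x \<in> cycles C j" for x j
    using that f f_zero by (auto simp: cycles_def chain_map_def linear_on_def)
  have fbd: "f j x \<in> boundaries D j" if x: "x \<in> boundaries C j" for x j
  proof -
    obtain w where w: "w \<in> chains C (j + 1)" "x = bdry C (j + 1) w"
      using x by (auto simp: boundaries_def)
    then have "f j x = bdry D (j + 1) (f (j + 1) w)"
      using f unfolding chain_map_def by (metis add_diff_cancel_right')
    moreover have "f (j + 1) w \<in> chains D (j + 1)"
      using lin w(1) by (simp add: linear_on_def)
    ultimately show ?thesis
      unfolding boundaries_def by blast
  qed
  have cdiff: "x - y \<in> cycles C j" if "x \<in> cycles C j" "y \<in> cycles C j" for x y j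
    using that bdiff c.subspace_diff[OF sub] by (auto simp: cycles_def)
  have czero: "0 \<in> cycles C j" for j
    using linear_on_zero[OF c.vector_space_axioms sub linb] c.subspace_0[OF sub]
    by (simp add: cycles_def)
  have fdiff: "f j (x - y) = f j x - f j y" if "x \<in> cycles C j" "y \<in> cycles C j" for x y j
    using that
    by (intro linear_on_diff[OF c.vector_space_axioms d.vector_space_axioms sub lin])
      (auto simp: cycles_def)
  have class_eq: "homologous E k `` {x} = homologous E k `` {y} \<longleftrightarrow> x - y \<in> boundaries E k"
    if "chain_complex E" "x \<in> cycles E k" "y \<in> cycles E k"
    for E :: "('g::field, 'z::ab_group_add) cpx" and k x y
    using that eq_equiv_class_iff[OF equiv_homologous[OF that(1)] that(2,3)]
    by (auto simp: homologous_def)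
  have map_class: "homology_map D f k (homologous C k `` {x}) = homologous D k `` {f k x}"
    if x: "x \<in> cycles C k" for k x
  proof -
    have "homologous D k `` {f k y} = homologous D k `` {f k x}" if "(x, y) \<in> homologous C k" for y
    proof -
      have y: "y \<in> cycles C k" "x - y \<in> boundaries C k"
        using that by (auto simp: homologous_def)
      then have "f k x - f k y \<in> boundaries D k"
        using fbd fdiff x by metis
      then show ?thesis
        using class_eq[OF D fcyc[OF x] fcyc[OF y(1)]] by simp
    qed
    moreover have "(x, x) \<in> homologous C k"
      using x equiv_homologous[OF C] equiv_class_self by fastforce
    ultimately show ?thesis
      unfolding homology_map_def by blast
  qed
  have inj: "inj_on (homology_map D f k) (homology C k) \<longleftrightarrow>
      (\<forall>x\<in>cycles C k. f k x \<in> boundaries D k \<longrightarrow> x \<in> boundaries C k)" (is "_ \<longleftrightarrow> ?inj") for k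
  proof -
    have "inj_on (homology_map D f k) (homology C k) \<longleftrightarrow>
        (\<forall>x\<in>cycles C k. \<forall>y\<in>cycles C k. f k (x - y) \<in> boundaries D k \<longrightarrow> x - y \<in> boundaries C k)"
      unfolding homology_def quotient_def inj_on_def
      by (simp add: map_class class_eq[OF C] class_eq[OF D] fcyc fdiff)
    also have "\<dots> \<longleftrightarrow> ?inj"
      using cdiff czero by (metis diff_zero)
    finally show ?thesis .
  qed
  have surj: "homology_map D f k ` homology C k = homology D k \<longleftrightarrow>
      (\<forall>z\<in>cycles D k. \<exists>x\<in>cycles C k. f k x - z \<in> boundaries D k)" (is "_ \<longleftrightarrow> ?surj") for k
  proof -
    have H: "homology E k = (\<lambda>x. homologous E k `` {x}) ` cycles E k"
      for E :: "('g::field, 'z::ab_group_add) cpx"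
      by (auto simp: homology_def quotient_def)
    have "homology_map D f k ` homology C k = (\<lambda>x. homologous D k `` {f k x}) ` cycles C k"
      unfolding H image_image using map_class by (intro image_cong) auto
    moreover have "\<dots> \<subseteq> homology D k"
      unfolding H using fcyc by auto
    ultimately have "homology_map D f k ` homology C k = homology D k \<longleftrightarrow>
        homology D k \<subseteq> (\<lambda>x. homologous D k `` {f k x}) ` cycles C k"
      by (metis subset_antisym subset_refl)
    also have "\<dots> \<longleftrightarrow>
        (\<forall>z\<in>cycles D k. \<exists>x\<in>cycles C k. homologous D k `` {z} = homologous D k `` {f k x})"
      unfolding H image_subset_iff image_iff ..
    also have "\<dots> \<longleftrightarrow>
        (\<forall>z\<in>cycles D k. \<exists>x\<in>cycles C k. homologous D k `` {f k x} = homologous D k `` {z})"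
      by (intro ball_cong bex_cong refl eq_commute)
    also have "\<dots> \<longleftrightarrow> ?surj"
      by (intro ball_cong bex_cong refl class_eq[OF D fcyc])
    finally show ?thesis .
  qed
  show ?thesis
    unfolding quasi_isomorphism_def bij_betw_def inj surj using f by blast
qed

lemma chain_complex_cpx_sum:
  assumes C: "chain_complex C" and D: "chain_complex D"
  shows "chain_complex (C \<oplus>\<^sub>c D)"
proof -
  interpret c: vector_space "scl C" using C by (simp add: chain_complex_def)
  interpret d: vector_space "scl D" using D by (simp add: chain_complex_def)
  interpret cd: vector_space "scl (C \<oplus>\<^sub>c D)"
    by unfold_locales
      (auto simp: cpx_sum_def c.scale_right_distrib c.scale_left_distrib
        d.scale_right_distrib d.scale_left_distrib)
  have "module.subspace (scl (C \<oplus>\<^sub>c D)) (chains (C \<oplus>\<^sub>c D) k)" for k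
    using C D unfolding cd.subspace_def
    by (auto simp: chain_complex_def c.subspace_def d.subspace_def cpx_sum_def zero_prod_def)
  then show ?thesis
    using C D cd.vector_space_axioms
    by (auto simp: chain_complex_def linear_on_def cpx_sum_def zero_prod_def)
qed

text \<open>
  Cycles and boundaries of a direct sum are products, so the description by representatives
  splits into the descriptions for the two summands.
\<close>

lemma quasi_isomorphism_cpx_sum:
  assumes cpx: "chain_complex C" "chain_complex D" "chain_complex C'" "chain_complex D'"
    and f: "quasi_isomorphism C C' f" and g: "quasi_isomorphism D D' g"
  shows "quasi_isomorphism (C \<oplus>\<^sub>c D) (C' \<oplus>\<^sub>c D') (\<lambda>k (x, y). (f k x, g k y))"
proof -
  have maps: "chain_map C C' f" "chain_map D D' g"
    using f g by (simp_all add: quasi_isomorphism_def)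
  have cycles: "cycles (A \<oplus>\<^sub>c B) k = cycles A k \<times> cycles B k"
    for A :: "('g, 'x::ab_group_add) cpx" and B :: "('g, 'y::ab_group_add) cpx" and k
    by (auto simp: cycles_def cpx_sum_def zero_prod_def)
  have boundaries: "boundaries (A \<oplus>\<^sub>c B) k = boundaries A k \<times> boundaries B k"
    for A :: "('g, 'x::ab_group_add) cpx" and B :: "('g, 'y::ab_group_add) cpx" and k
    by (force simp: boundaries_def cpx_sum_def)
  have map: "chain_map (C \<oplus>\<^sub>c D) (C' \<oplus>\<^sub>c D') (\<lambda>k (x, y). (f k x, g k y))"
    using maps by (auto simp: chain_map_def linear_on_def cpx_sum_def)
  note iff = quasi_isomorphism_iff[OF cpx(1,3) maps(1)] quasi_isomorphism_iff[OF cpx(2,4) maps(2)]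
    quasi_isomorphism_iff[OF chain_complex_cpx_sum[OF cpx(1,2)] chain_complex_cpx_sum[OF cpx(3,4)] map]
  show ?thesis
    using f g unfolding iff cycles boundaries
    by (simp add: Ball_def Bex_def) blast
qed

section \<open>Incidence numbers\<close>

lemma omit_takeWhile:
  assumes "distinct vs" "a \<in> set vs"
  shows "omit (length (takeWhile (\<lambda>v. v \<noteq> a) vs)) vs = filter (\<lambda>v. v \<noteq> a) vs"
  using assms
proof (induction vs)
  case (Cons b vs)
  show ?case
  proof (cases "b = a")
    case True
    with Cons.prems have "filter (\<lambda>v. v \<noteq> a) vs = vs"
      by (auto intro!: filter_True)
    with True show ?thesis by (simp add: omit_def)
  qed (use Cons in \<open>auto simp: omit_def\<close>)
qed simp

text \<open>
  As the entries of the list are distinct, the position omitted can be read off from the set of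
  remaining entries. This makes the sign of an incidence number well defined.
\<close>

lemma omit_inject:
  assumes "distinct vs" "i < length vs" "j < length vs" "omit i vs = omit j vs"
  shows "i = j"
proof -
  have set_omit: "set (omit k vs) = set vs - {vs ! k}" if "k < length vs" for k
  proof -
    have "vs = take k vs @ vs ! k # drop (Suc k) vs"
      using that by (rule id_take_nth_drop)
    moreover from this have "distinct (take k vs @ vs ! k # drop (Suc k) vs)"
      using assms(1) by simp
    ultimately show ?thesis
      unfolding omit_def
      by (metis (no_types, lifting) Diff_insert_absorb Un_insert_right distinct.simps(2) distinct_append
          disjoint_insert(2) insert_iff list.simps(15) set_append Un_iff)
  qed
  have "set vs - {vs ! i} = set vs - {vs ! j}"
    using set_omit assms by metis
  then have "vs ! i = vs ! j"
    using assms(2,3) by (metis Diff_iff insert_iff nth_mem singletonD)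
  then show ?thesis
    using assms nth_eq_iff_index_eq by blast
qed

text \<open>
  The sign rule behind \<open>\<partial> \<partial> = 0\<close>: removing the earlier of two entries lowers the position of the
  later one by one, while removing the later one does not move the earlier one.
\<close>

lemma position_filter:
  assumes "distinct vs" "a \<in> set vs" "b \<in> set vs" "a \<noteq> b"
  defines "pos \<equiv> \<lambda>c ws. length (takeWhile (\<lambda>v. v \<noteq> c) ws)"
  shows "even (pos a vs + pos b (filter (\<lambda>v. v \<noteq> a) vs)) \<longleftrightarrow>
    odd (pos b vs + pos a (filter (\<lambda>v. v \<noteq> b) vs))"
  using assms(1-4)
proof (induction vs)
  case (Cons c vs)
  have keep: "filter (\<lambda>v. v \<noteq> x) ws = ws" if "x \<notin> set ws" for x :: 'a and ws
    using that by (auto intro!: filter_True)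
  show ?case
    using Cons keep[of a vs] keep[of b vs] by (auto simp: pos_def)
qed simp

locale cosheaf_on_complex =
  fixes K :: "'a set set"
    and ori :: "'a set \<Rightarrow> 'a list"
    and C :: "('f::field, 'a, 'v::ab_group_add) cosheaf_data"
  assumes complex: "simplicial_complex K"
    and orientation: "local_orientation K ori"
    and cosheaf: "cosheaf K C"
begin

abbreviation sc :: "'f \<Rightarrow> 'v \<Rightarrow> 'v" where "sc \<equiv> vscale C"
abbreviation inc :: "'a set \<Rightarrow> 'a set \<Rightarrow> int" where "inc \<equiv> incidence ori"
abbreviation Ch :: "int \<Rightarrow> ('a set \<Rightarrow> 'v) set" where "Ch \<equiv> chains (simplicial_chains ori K C)"
abbreviation d :: "int \<Rightarrow> ('a set \<Rightarrow> 'v) \<Rightarrow> ('a set \<Rightarrow> 'v)" where "d \<equiv> bdry (simplicial_chains ori K C)"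

text \<open>
  The block of the simplicial boundary map from \<open>\<sigma>\<close> to \<open>\<tau>\<close>. Including the incidence number makes
  it linear for all pairs of simplices, as it is zero when \<open>\<tau>\<close> is not a facet of \<open>\<sigma>\<close>.
\<close>

definition face_map :: "'a set \<Rightarrow> 'a set \<Rightarrow> 'v \<Rightarrow> 'v" where
  "face_map \<sigma> \<tau> v = sc (of_int (inc \<sigma> \<tau>)) (ext C \<sigma> \<tau> v)"

sublocale vs: vector_space sc
  using cosheaf by (simp add: cosheaf_def)

sublocale fam: vector_space "\<lambda>c (x :: 'a set \<Rightarrow> 'v) \<sigma>. sc c (x \<sigma>)"
  by (rule vector_space_Pi) (rule vs.vector_space_axioms)

lemma finite_complex: "finite K"
  and finite_simplex: "\<sigma> \<in> K \<Longrightarrow> finite \<sigma>"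
  and face_closed: "\<sigma> \<in> K \<Longrightarrow> \<tau> \<subseteq> \<sigma> \<Longrightarrow> \<tau> \<noteq> {} \<Longrightarrow> \<tau> \<in> K"
  and simplex_nonempty: "\<sigma> \<in> K \<Longrightarrow> \<sigma> \<noteq> {}"
  using complex unfolding simplicial_complex_def by blast+

lemma finite_simplices: "finite (simplices K k)"
  using finite_complex by (simp add: simplices_def)

lemma subspace_stalk: "\<sigma> \<in> K \<Longrightarrow> vs.subspace (stalk C \<sigma>)"
  using cosheaf by (simp add: cosheaf_def)

lemma linear_ext:
  "\<sigma> \<in> K \<Longrightarrow> \<tau> \<in> K \<Longrightarrow> \<tau> \<subseteq> \<sigma> \<Longrightarrow> linear_on sc sc (stalk C \<sigma>) (stalk C \<tau>) (ext C \<sigma> \<tau>)"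
  using cosheaf by (simp add: cosheaf_def)

lemma orientation_distinct: "\<sigma> \<in> K \<Longrightarrow> distinct (ori \<sigma>)"
  and orientation_set: "\<sigma> \<in> K \<Longrightarrow> set (ori \<sigma>) = \<sigma>"
  using orientation unfolding local_orientation_def by blast+

lemma orientation_remove:
  assumes "\<sigma> \<in> K" "\<sigma> - {a} \<in> K"
  shows "ori (\<sigma> - {a}) = filter (\<lambda>v. v \<noteq> a) (ori \<sigma>)"
proof -
  have "ori (\<sigma> - {a}) = filter (\<lambda>v. v \<in> \<sigma> - {a}) (ori \<sigma>)"
    using orientation[unfolded local_orientation_def, THEN conjunct2, rule_format, OF assms]
    by simp
  also have "\<dots> = filter (\<lambda>v. v \<noteq> a) (ori \<sigma>)"
    by (intro filter_cong) (auto simp: orientation_set[OF assms(1)])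
  finally show ?thesis .
qed

lemma incidence_remove:
  assumes "\<sigma> \<in> K" "\<sigma> - {a} \<in> K" "a \<in> \<sigma>"
  shows "inc \<sigma> (\<sigma> - {a}) = (- 1) ^ length (takeWhile (\<lambda>v. v \<noteq> a) (ori \<sigma>))"
proof -
  let ?n = "length (takeWhile (\<lambda>v. v \<noteq> a) (ori \<sigma>))"
  have a: "a \<in> set (ori \<sigma>)" "distinct (ori \<sigma>)"
    using assms(3) by (simp_all add: orientation_set[OF assms(1)] orientation_distinct[OF assms(1)])
  have n: "?n < length (ori \<sigma>)"
    using a by (metis (mono_tags, lifting) le_neq_implies_less length_takeWhile_le order_refl
        takeWhile_eq_all_conv takeWhile_eq_take take_all)
  have "ori (\<sigma> - {a}) = omit ?n (ori \<sigma>)"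
    using orientation_remove omit_takeWhile assms a by metis
  then have "i < length (ori \<sigma>) \<and> P i \<and> ori (\<sigma> - {a}) = omit i (ori \<sigma>) \<longleftrightarrow> i = ?n \<and> P i" for i P
    using omit_inject[OF a(2) _ n] n by metis
  then have "(\<exists>i<length (ori \<sigma>). P i \<and> ori (\<sigma> - {a}) = omit i (ori \<sigma>)) \<longleftrightarrow> P ?n" for P
    by simp
  from this[of even] this[of odd] show ?thesis
    unfolding incidence_def by (simp only: minus_one_power_iff split: if_splits) simp
qed

lemma incidence_nonzero_iff:
  assumes "\<sigma> \<in> K" "\<tau> \<in> K"
  shows "inc \<sigma> \<tau> \<noteq> 0 \<longleftrightarrow> \<tau> \<lhd>\<^sub>1 \<sigma>"
proof
  assume "inc \<sigma> \<tau> \<noteq> 0"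
  then obtain i where i: "i < length (ori \<sigma>)" "ori \<tau> = omit i (ori \<sigma>)"
    by (auto simp: incidence_def split: if_splits)
  have "set (ori \<tau>) \<subseteq> set (ori \<sigma>)"
    using i set_take_subset set_drop_subset by (fastforce simp: omit_def)
  moreover have "length (ori \<sigma>) = Suc (length (ori \<tau>))"
    using i by (auto simp: omit_def)
  ultimately show "\<tau> \<lhd>\<^sub>1 \<sigma>"
    using assms orientation_set orientation_distinct distinct_card
    unfolding codim_one_face_def by metis
next
  assume face: "\<tau> \<lhd>\<^sub>1 \<sigma>"
  have "finite \<tau>" "finite \<sigma>"
    using assms finite_simplex by auto
  then have "card (\<sigma> - \<tau>) = 1"
    using face by (simp add: codim_one_face_def card_Diff_subset)
  then obtain a where "\<sigma> - \<tau> = {a}"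
    by (auto simp: card_1_singleton_iff)
  then have "\<tau> = \<sigma> - {a}" "a \<in> \<sigma>"
    using face by (auto simp: codim_one_face_def)
  then show "inc \<sigma> \<tau> \<noteq> 0"
    using incidence_remove assms by auto
qed

lemma incidence_square:
  assumes "\<sigma> \<in> K" "\<tau> \<in> K" "\<tau> \<lhd>\<^sub>1 \<sigma>"
  shows "inc \<sigma> \<tau> * inc \<sigma> \<tau> = 1"
  using incidence_nonzero_iff[OF assms(1,2)] assms(3) by (auto simp: incidence_def split: if_splits)

text \<open>
  If \<open>\<upsilon>\<close> arises from \<open>\<sigma>\<close> by deleting the vertices \<open>a\<close> and \<open>b\<close>, only the two simplices that lack
  exactly one of them contribute, and their contributions have opposite signs.
\<close>

lemma incidence_sum_zero:
  assumes "\<sigma> \<in> simplices K k" "\<upsilon> \<in> simplices K (k - 2)"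
  shows "(\<Sum>\<tau>\<in>simplices K (k - 1). inc \<sigma> \<tau> * inc \<tau> \<upsilon>) = 0"
proof (cases "\<upsilon> \<subseteq> \<sigma>")
  case False
  have "inc \<sigma> \<tau> * inc \<tau> \<upsilon> = 0" if "\<tau> \<in> simplices K (k - 1)" for \<tau>
  proof (rule ccontr)
    assume "inc \<sigma> \<tau> * inc \<tau> \<upsilon> \<noteq> 0"
    then have "\<tau> \<lhd>\<^sub>1 \<sigma>" "\<upsilon> \<lhd>\<^sub>1 \<tau>"
      using incidence_nonzero_iff that assms by (auto simp: simplices_def)
    with False show False by (auto simp: codim_one_face_def)
  qed
  then show ?thesis by (intro sum.neutral ballI)
next
  case True
  have K: "\<sigma> \<in> K" "\<upsilon> \<in> K"
    using assms by (auto simp: simplices_def)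
  define pos where "pos c ws = length (takeWhile (\<lambda>v. v \<noteq> c) ws)" for c and ws :: "'a list"
  note fin = finite_simplex[OF K(1)] finite_simplex[OF K(2)]
  have "int (card \<sigma>) = int (card \<upsilon>) + 2"
    using assms by (simp add: simplices_def)
  then have "card (\<sigma> - \<upsilon>) = 2"
    using fin True by (simp add: card_Diff_subset)
  then obtain a b where ab: "\<sigma> - \<upsilon> = {a, b}" "a \<noteq> b"
    by (auto simp: card_2_iff)
  have \<upsilon>: "\<upsilon> = \<sigma> - {a} - {b}" "\<upsilon> = \<sigma> - {b} - {a}" "a \<in> \<sigma>" "b \<in> \<sigma>"
    using ab(1) True by blast+
  have mem: "\<sigma> - {a} \<in> K" "\<sigma> - {b} \<in> K"
    using ab(2) \<upsilon>(3,4) by (auto intro!: face_closed[OF K(1)])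
  have card_rm: "int (card (\<sigma> - {c})) = k" if "c \<in> \<sigma>" for c
  proof -
    have "card \<sigma> = Suc (card (\<sigma> - {c}))"
      using fin(1) that by (rule card.remove)
    then show ?thesis using assms by (simp add: simplices_def)
  qed
  have sub: "{\<sigma> - {a}, \<sigma> - {b}} \<subseteq> simplices K (k - 1)"
    using mem card_rm \<upsilon>(3,4) by (simp add: simplices_def)
  have other: "inc \<sigma> \<tau> * inc \<tau> \<upsilon> = 0"
    if "\<tau> \<in> simplices K (k - 1) - {\<sigma> - {a}, \<sigma> - {b}}" for \<tau>
  proof (rule ccontr)
    assume "inc \<sigma> \<tau> * inc \<tau> \<upsilon> \<noteq> 0"
    then have face: "\<tau> \<lhd>\<^sub>1 \<sigma>" "\<upsilon> \<lhd>\<^sub>1 \<tau>"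
      using incidence_nonzero_iff that K by (auto simp: simplices_def)
    then have "\<sigma> - \<tau> \<subseteq> {a, b}" "card (\<sigma> - \<tau>) = 1"
      using ab(1) fin by (auto simp: codim_one_face_def card_Diff_subset finite_subset)
    then have "\<sigma> - \<tau> = {a} \<or> \<sigma> - \<tau> = {b}"
      by (auto simp: card_1_singleton_iff)
    then have "\<tau> = \<sigma> - {a} \<or> \<tau> = \<sigma> - {b}"
      using face by (auto simp: codim_one_face_def)
    then show False using that by simp
  qed
  have "(\<Sum>\<tau>\<in>simplices K (k - 1). inc \<sigma> \<tau> * inc \<tau> \<upsilon>) =
      (\<Sum>\<tau>\<in>{\<sigma> - {a}, \<sigma> - {b}}. inc \<sigma> \<tau> * inc \<tau> \<upsilon>)"
    using other by (intro sum.mono_neutral_right finite_simplices sub) auto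
  also have "\<dots> = inc \<sigma> (\<sigma> - {a}) * inc (\<sigma> - {a}) (\<sigma> - {a} - {b}) +
      inc \<sigma> (\<sigma> - {b}) * inc (\<sigma> - {b}) (\<sigma> - {b} - {a})"
    using ab(2) \<upsilon>(3,4) by (subst sum.insert) (auto simp flip: \<upsilon>(1,2))
  also have "\<dots> = (- 1) ^ (pos a (ori \<sigma>) + pos b (filter (\<lambda>v. v \<noteq> a) (ori \<sigma>))) +
      (- 1) ^ (pos b (ori \<sigma>) + pos a (filter (\<lambda>v. v \<noteq> b) (ori \<sigma>)))"
    using K mem \<upsilon>(3,4) ab(2) K(2)[unfolded \<upsilon>(1)] K(2)[unfolded \<upsilon>(2)]
    by (simp add: incidence_remove orientation_remove pos_def power_add)
  also have "\<dots> = 0"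
    using position_filter[of "ori \<sigma>" a b] \<upsilon>(3,4) ab(2)
      orientation_distinct[OF K(1)] orientation_set[OF K(1)]
    by (simp add: minus_one_power_iff pos_def)
  finally show ?thesis .
qed

section \<open>The simplicial chain complex of a cosheaf\<close>

lemma linear_face_map:
  assumes "\<sigma> \<in> K" "\<tau> \<in> K"
  shows "linear_on sc sc (stalk C \<sigma>) (stalk C \<tau>) (face_map \<sigma> \<tau>)"
proof (cases "\<tau> \<lhd>\<^sub>1 \<sigma>")
  case True
  then show ?thesis
    using linear_on_scale[OF vs.vector_space_axioms subspace_stalk linear_ext] assms
    unfolding face_map_def[abs_def] codim_one_face_def by blast
next
  case False
  then have "face_map \<sigma> \<tau> = (\<lambda>v. 0)"
    using incidence_nonzero_iff[OF assms] by (auto simp: face_map_def[abs_def])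
  then show ?thesis
    using vs.subspace_0[OF subspace_stalk] assms by (simp add: linear_on_def)
qed

lemma face_map_mem: "\<sigma> \<in> K \<Longrightarrow> \<tau> \<in> K \<Longrightarrow> v \<in> stalk C \<sigma> \<Longrightarrow> face_map \<sigma> \<tau> v \<in> stalk C \<tau>"
  using linear_face_map unfolding linear_on_def by blast

lemma face_map_zero: "\<sigma> \<in> K \<Longrightarrow> \<tau> \<in> K \<Longrightarrow> face_map \<sigma> \<tau> 0 = 0"
  using linear_on_zero[OF vs.vector_space_axioms subspace_stalk linear_face_map] .

lemma face_map_sum:
  assumes "\<sigma> \<in> K" "\<tau> \<in> K" "\<And>i. i \<in> A \<Longrightarrow> g i \<in> stalk C \<sigma>"
  shows "face_map \<sigma> \<tau> (\<Sum>i\<in>A. g i) = (\<Sum>i\<in>A. face_map \<sigma> \<tau> (g i))"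
  using linear_on_sum[OF vs.vector_space_axioms subspace_stalk linear_face_map] assms by blast

lemma face_map_nonface: "\<sigma> \<in> K \<Longrightarrow> \<tau> \<in> K \<Longrightarrow> \<not> \<tau> \<lhd>\<^sub>1 \<sigma> \<Longrightarrow> face_map \<sigma> \<tau> v = 0"
  using incidence_nonzero_iff[of \<sigma> \<tau>] by (simp add: face_map_def)

lemma scl_chains: "scl (simplicial_chains ori K C) = (\<lambda>c x \<sigma>. sc c (x \<sigma>))"
  and chains_eq: "Ch k = stalk_sum C (simplices K k)"
  by (simp_all add: simplicial_chains_def)

lemma boundary_eq:
  "d k x \<tau> = (if \<tau> \<in> simplices K (k - 1) then \<Sum>\<sigma>\<in>simplices K k. face_map \<sigma> \<tau> (x \<sigma>) else 0)"
  by (simp add: simplicial_chains_def block_map_def face_map_def)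

lemma subspace_stalk_sum: "X \<subseteq> K \<Longrightarrow> fam.subspace (stalk_sum C X)"
  using vs.subspace_0[OF subspace_stalk] vs.subspace_add[OF subspace_stalk]
    vs.subspace_scale[OF subspace_stalk]
  unfolding fam.subspace_def stalk_sum_def by (auto simp: subset_iff)

lemma subspace_chains: "fam.subspace (Ch k)"
  unfolding chains_eq by (rule subspace_stalk_sum) (auto simp: simplices_def)

lemma chain_mem: "x \<in> Ch k \<Longrightarrow> \<sigma> \<in> K \<Longrightarrow> x \<sigma> \<in> stalk C \<sigma>"
  using vs.subspace_0[OF subspace_stalk] by (cases "\<sigma> \<in> simplices K k") (auto simp: chains_eq stalk_sum_def)

lemma linear_boundary:
  "linear_on (\<lambda>c x \<sigma>. sc c (x \<sigma>)) (\<lambda>c x \<sigma>. sc c (x \<sigma>)) (Ch k) (Ch (k - 1)) (d k)"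
  unfolding linear_on_def
proof (intro conjI ballI allI)
  fix x assume x: "x \<in> Ch k"
  show "d k x \<in> Ch (k - 1)"
    using chain_mem[OF x]
    by (auto simp: chains_eq[of "k - 1"] stalk_sum_def boundary_eq simplices_def face_map_mem
        intro!: vs.subspace_sum[OF subspace_stalk])
  fix c
  show "d k (\<lambda>\<sigma>. sc c (x \<sigma>)) = (\<lambda>\<sigma>. sc c (d k x \<sigma>))"
    using linear_face_map chain_mem[OF x]
    by (auto simp: boundary_eq vs.scale_sum_right simplices_def linear_on_def intro!: sum.cong)
  fix y assume y: "y \<in> Ch k"
  show "d k (x + y) = d k x + d k y"
    using linear_face_map chain_mem[OF x] chain_mem[OF y]
    by (auto simp: boundary_eq simplices_def linear_on_def simp flip: sum.distrib intro!: sum.cong)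
qed

lemma face_map_comp:
  assumes "\<sigma> \<in> K" "\<tau> \<in> K" "\<upsilon> \<in> K" "v \<in> stalk C \<sigma>"
  shows "face_map \<tau> \<upsilon> (face_map \<sigma> \<tau> v) = sc (of_int (inc \<sigma> \<tau> * inc \<tau> \<upsilon>)) (ext C \<sigma> \<upsilon> v)"
proof (cases "\<tau> \<lhd>\<^sub>1 \<sigma> \<and> \<upsilon> \<lhd>\<^sub>1 \<tau>")
  case True
  then have sub: "\<tau> \<subseteq> \<sigma>" "\<upsilon> \<subseteq> \<tau>"
    by (auto simp: codim_one_face_def)
  have "ext C \<tau> \<upsilon> (sc c (ext C \<sigma> \<tau> v)) = sc c (ext C \<tau> \<upsilon> (ext C \<sigma> \<tau> v))" for c
    using linear_ext[OF assms(1,2) sub(1)] linear_ext[OF assms(2,3) sub(2)] assms(4)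
    by (simp add: linear_on_def)
  moreover have "ext C \<tau> \<upsilon> (ext C \<sigma> \<tau> v) = ext C \<sigma> \<upsilon> v"
    using cosheaf assms sub by (simp add: cosheaf_def)
  ultimately show ?thesis
    by (simp add: face_map_def mult.commute)
next
  case False
  then consider "inc \<sigma> \<tau> = 0" | "inc \<tau> \<upsilon> = 0"
    using incidence_nonzero_iff assms by blast
  then show ?thesis
    using face_map_zero assms by cases (auto simp: face_map_def)
qed

text \<open>
  By functoriality the extension map from \<open>\<sigma>\<close> to a face \<open>\<upsilon>\<close> of codimension two does not depend on
  the simplex in between, so only the incidence numbers have to be summed.
\<close>

lemma boundary_boundary:
  assumes x: "x \<in> Ch k"
  shows "d (k - 1) (d k x) = 0"
proof
  fix \<upsilon>
  show "d (k - 1) (d k x) \<upsilon> = 0 \<upsilon>"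
  proof (cases "\<upsilon> \<in> simplices K (k - 2)")
    case True
    have "d (k - 1) (d k x) \<upsilon> =
        (\<Sum>\<tau>\<in>simplices K (k - 1). face_map \<tau> \<upsilon> (\<Sum>\<sigma>\<in>simplices K k. face_map \<sigma> \<tau> (x \<sigma>)))"
      using True by (simp add: boundary_eq)
    also have "\<dots> = (\<Sum>\<tau>\<in>simplices K (k - 1). \<Sum>\<sigma>\<in>simplices K k.
        sc (of_int (inc \<sigma> \<tau> * inc \<tau> \<upsilon>)) (ext C \<sigma> \<upsilon> (x \<sigma>)))"
      using True chain_mem[OF x]
      by (intro sum.cong refl, subst face_map_sum)
        (auto simp: face_map_mem face_map_comp simplices_def)
    also have "\<dots> = (\<Sum>\<sigma>\<in>simplices K k. \<Sum>\<tau>\<in>simplices K (k - 1).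
        sc (of_int (inc \<sigma> \<tau> * inc \<tau> \<upsilon>)) (ext C \<sigma> \<upsilon> (x \<sigma>)))"
      by (rule sum.swap)
    also have "\<dots> = (\<Sum>\<sigma>\<in>simplices K k.
        sc (of_int (\<Sum>\<tau>\<in>simplices K (k - 1). inc \<sigma> \<tau> * inc \<tau> \<upsilon>)) (ext C \<sigma> \<upsilon> (x \<sigma>)))"
      by (simp only: vs.scale_sum_left of_int_sum)
    also have "\<dots> = 0"
      using incidence_sum_zero[OF _ True] by simp
    finally show ?thesis by simp
  qed (simp add: boundary_eq)
qed

lemma chain_complex_simplicial: "chain_complex (simplicial_chains ori K C)"
  unfolding chain_complex_def scl_chains
  using fam.vector_space_axioms subspace_chains linear_boundary boundary_boundary by blast

end

section \<open>Paths of an acyclic matching and their weights\<close>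

lemma zigzag_map_snoc:
  "\<rho> \<noteq> [] \<Longrightarrow> zigzag_map C (\<rho> @ [(\<sigma>, \<tau>)]) =
     stalk_inv C \<tau> \<sigma> \<circ> ext C (snd (last \<rho>)) \<sigma> \<circ> zigzag_map C \<rho>"
proof (induction \<rho> rule: induct_list012)
  case (2 p)
  then show ?case by (cases p) (simp add: comp_assoc)
next
  case (3 p q \<rho>)
  then show ?case by (cases p; cases q) (simp add: comp_assoc)
qed simp

lemma path_sign_snoc:
  assumes "\<rho> \<noteq> []"
  shows "path_sign ori (\<rho> @ [(\<sigma>, \<tau>)]) =
    - (incidence ori \<tau> \<sigma> * incidence ori (snd (last \<rho>)) \<sigma> * path_sign ori \<rho>)"
proof -
  obtain n where n: "length \<rho> = Suc n"
    using assms by (cases \<rho>) auto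
  have last: "last \<rho> = \<rho> ! n"
    using assms n by (simp add: last_conv_nth)
  show ?thesis
    by (simp add: path_sign_def n last nth_append prod.lessThan_Suc)
qed

locale acyclic_cosheaf_matching = cosheaf_on_complex K ori C
  for K :: "'a set set" and ori and C :: "('f::field, 'a, 'v::ab_group_add) cosheaf_data" +
  fixes \<Sigma> :: "('a set \<times> 'a set) set"
  assumes acyclic: "acyclic_matching K \<Sigma>"
    and compatible: "cosheaf_compatible C \<Sigma>"
begin

abbreviation paths :: "('a set \<times> 'a set) list set" where "paths \<equiv> matching_paths \<Sigma>"
abbreviation weight :: "('a set \<times> 'a set) list \<Rightarrow> 'v \<Rightarrow> 'v" where "weight \<equiv> path_weight ori C"

lemma matched:
  assumes "p \<in> \<Sigma>"
  shows "fst p \<in> K" "snd p \<in> K" "fst p \<lhd>\<^sub>1 snd p"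
    "bij_betw (ext C (snd p) (fst p)) (stalk C (snd p)) (stalk C (fst p))"
  using assms acyclic compatible
  by (auto simp: acyclic_matching_def partial_matching_def cosheaf_compatible_def)

lemma matched_disjoint:
  assumes "p \<in> \<Sigma>" "q \<in> \<Sigma>" "{fst p, snd p} \<inter> {fst q, snd q} \<noteq> {}"
  shows "p = q"
  using assms acyclic unfolding acyclic_matching_def partial_matching_def by blast

lemma matched_distinct: "p \<in> \<Sigma> \<Longrightarrow> q \<in> \<Sigma> \<Longrightarrow> fst p \<noteq> snd q"
  using matched_disjoint[of p q] matched(3)[of p] by (auto simp: codim_one_face_def)

lemma finite_matching: "finite \<Sigma>"
proof (rule finite_subset)
  show "\<Sigma> \<subseteq> K \<times> K"
    using matched(1,2) by fastforce
qed (simp add: finite_complex)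

text \<open>
  Each of the two components of a matched pair determines the pair, so distinctness of the
  simplices on a path is distinctness of its pairs.
\<close>

lemma path_iff:
  "\<rho> \<in> paths \<longleftrightarrow> \<rho> \<noteq> [] \<and> set \<rho> \<subseteq> \<Sigma> \<and> distinct \<rho> \<and>
     (\<forall>i. Suc i < length \<rho> \<longrightarrow> fst (\<rho> ! Suc i) \<lhd>\<^sub>1 snd (\<rho> ! i))"
proof -
  have "distinct (map fst \<rho> @ map snd \<rho>) \<longleftrightarrow> distinct \<rho>" if sub: "set \<rho> \<subseteq> \<Sigma>"
  proof -
    have "inj_on fst (set \<rho>)" "inj_on snd (set \<rho>)"
      using matched_disjoint sub by (fastforce intro!: inj_onI)+
    moreover have "fst ` set \<rho> \<inter> snd ` set \<rho> = {}"
      using matched_distinct sub by blast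
    ultimately show ?thesis
      by (auto simp: distinct_map)
  qed
  then show ?thesis
    unfolding matching_paths_def by blast
qed

lemma finite_paths: "finite paths"
  by (rule finite_subset[OF _ finite_subset_distinct[OF finite_matching]]) (auto simp: path_iff)

lemma path_end_in:
  assumes "\<rho> \<in> paths"
  shows "\<rho> \<noteq> []" "hd \<rho> \<in> \<Sigma>" "last \<rho> \<in> \<Sigma>"
  using assms by (auto simp: path_iff)

lemma path_end_simplices:
  assumes "\<rho> \<in> paths"
  shows "fst (hd \<rho>) \<in> K" "snd (last \<rho>) \<in> K"
  using matched(1)[OF path_end_in(2)[OF assms]] matched(2)[OF path_end_in(3)[OF assms]] .

lemma path_gradient:
  "\<rho> \<in> paths \<Longrightarrow> fst (hd \<rho>) \<subseteq> snd (last \<rho>) \<Longrightarrow> length \<rho> = 1"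
  using acyclic unfolding acyclic_matching_def gradient_path_def by blast

lemma path_singleton: "p \<in> \<Sigma> \<Longrightarrow> [p] \<in> paths"
  by (simp add: path_iff)

lemma path_drop:
  assumes "\<rho> \<in> paths" "i < length \<rho>"
  shows "drop i \<rho> \<in> paths"
  using assms by (auto simp: path_iff dest: in_set_dropD)

lemma path_take:
  assumes "\<rho> \<in> paths" "0 < i"
  shows "take i \<rho> \<in> paths"
  using assms by (auto simp: path_iff dest: in_set_takeD)

text \<open>
  This and the next lemma use acyclicity: an extension of a path that returned to a pair already
  visited would close a path of length at least two whose first simplex is a face of its last.
\<close>

lemma path_snoc:
  assumes \<rho>: "\<rho> \<in> paths" and p: "p \<in> \<Sigma>" "fst p \<lhd>\<^sub>1 snd (last \<rho>)" "p \<noteq> last \<rho>"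
  shows "\<rho> @ [p] \<in> paths"
proof -
  have ne: "\<rho> \<noteq> []" using \<rho> by (simp add: path_iff)
  have "p \<notin> set \<rho>"
  proof
    assume "p \<in> set \<rho>"
    then obtain i where i: "i < length \<rho>" "\<rho> ! i = p"
      by (auto simp: in_set_conv_nth)
    have "length (drop i \<rho>) = 1"
      using i p by (intro path_gradient path_drop \<rho>) (auto simp: hd_drop_conv_nth codim_one_face_def)
    then have "i = length \<rho> - 1" by simp
    then show False
      using i p(3) ne by (simp add: last_conv_nth)
  qed
  moreover have "fst ((\<rho> @ [p]) ! Suc i) \<lhd>\<^sub>1 snd ((\<rho> @ [p]) ! i)" if "Suc i < length (\<rho> @ [p])" for i
  proof (cases "Suc i < length \<rho>")
    case True
    with \<rho> show ?thesis by (simp add: path_iff nth_append)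
  next
    case False
    with that have "length \<rho> = Suc i" by simp
    with p(2) ne show ?thesis by (simp add: nth_append last_conv_nth)
  qed
  ultimately show ?thesis
    using \<rho> p(1) by (auto simp: path_iff)
qed

lemma path_cons:
  assumes \<rho>: "\<rho> \<in> paths" and p: "p \<in> \<Sigma>" "fst (hd \<rho>) \<lhd>\<^sub>1 snd p" "p \<noteq> hd \<rho>"
  shows "p # \<rho> \<in> paths"
proof -
  have ne: "\<rho> \<noteq> []" using \<rho> by (simp add: path_iff)
  have "p \<notin> set \<rho>"
  proof
    assume "p \<in> set \<rho>"
    then obtain i where i: "i < length \<rho>" "\<rho> ! i = p"
      by (auto simp: in_set_conv_nth)
    have "last (take (Suc i) \<rho>) = p"
      using i by (simp add: take_Suc_conv_app_nth)
    then have "length (take (Suc i) \<rho>) = 1"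
      using i p by (intro path_gradient path_take \<rho>) (auto simp: codim_one_face_def)
    then have "i = 0" using i by simp
    then show False
      using i p(3) ne by (simp add: hd_conv_nth)
  qed
  moreover have "fst ((p # \<rho>) ! Suc i) \<lhd>\<^sub>1 snd ((p # \<rho>) ! i)" if "Suc i < length (p # \<rho>)" for i
    using that \<rho> p(2) ne by (cases i) (auto simp: path_iff hd_conv_nth)
  ultimately show ?thesis
    using \<rho> p(1) by (auto simp: path_iff)
qed

lemma path_snocD:
  assumes "\<rho> @ [p] \<in> paths" "\<rho> \<noteq> []"
  shows "\<rho> \<in> paths" "p \<in> \<Sigma>" "fst p \<lhd>\<^sub>1 snd (last \<rho>)" "p \<noteq> last \<rho>"
proof -
  have "take (length \<rho>) (\<rho> @ [p]) \<in> paths"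
    using assms by (intro path_take) auto
  then show "\<rho> \<in> paths" by simp
  have "Suc (length \<rho> - 1) = length \<rho>"
    using assms(2) by simp
  then show "fst p \<lhd>\<^sub>1 snd (last \<rho>)"
    using assms unfolding path_iff
    by (metis append_is_Nil_conv last_conv_nth length_append_singleton lessI nth_append nth_append_length)
  show "p \<in> \<Sigma>" "p \<noteq> last \<rho>"
    using assms by (auto simp: path_iff)
qed

lemma path_card: "\<rho> \<in> paths \<Longrightarrow> card (snd (last \<rho>)) = Suc (card (fst (hd \<rho>)))"
proof (induction \<rho> rule: rev_induct)
  case (snoc p \<rho>)
  show ?case
  proof (cases "\<rho> = []")
    case True
    with snoc.prems show ?thesis
      using matched(3)[of p] by (simp add: path_iff codim_one_face_def)
  next
    case False
    note D = path_snocD[OF snoc.prems False]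
    with snoc.IH matched(3)[OF D(2)] False show ?thesis
      by (simp add: codim_one_face_def)
  qed
qed (simp add: path_iff)

lemma linear_stalk_inv:
  assumes "p \<in> \<Sigma>"
  shows "linear_on sc sc (stalk C (fst p)) (stalk C (snd p)) (stalk_inv C (snd p) (fst p))"
proof -
  have "fst p \<subseteq> snd p"
    using matched(3)[OF assms] by (simp add: codim_one_face_def)
  then show ?thesis
    unfolding stalk_inv_def using matched[OF assms] linear_ext subspace_stalk
    by (intro linear_on_inv_into vs.vector_space_axioms) auto
qed

lemma linear_zigzag:
  "\<rho> \<in> paths \<Longrightarrow> linear_on sc sc (stalk C (fst (hd \<rho>))) (stalk C (snd (last \<rho>))) (zigzag_map C \<rho>)"
proof (induction \<rho> rule: rev_induct)
  case (snoc p \<rho>)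
  obtain \<sigma> \<tau> where p: "p = (\<sigma>, \<tau>)" by (cases p)
  show ?case
  proof (cases "\<rho> = []")
    case True
    with snoc.prems show ?thesis
      using linear_stalk_inv[of p] by (simp add: path_iff p)
  next
    case False
    note D = path_snocD[OF snoc.prems False]
    have "linear_on sc sc (stalk C (snd (last \<rho>))) (stalk C \<sigma>) (ext C (snd (last \<rho>)) \<sigma>)"
      using D(3) matched(1)[OF D(2)] matched(2)[OF path_end_in(3)[OF D(1)]]
      by (intro linear_ext) (auto simp: codim_one_face_def p)
    then show ?thesis
      using linear_on_comp[OF linear_on_comp[OF snoc.IH[OF D(1)]] linear_stalk_inv[OF D(2)]] False
      by (simp add: zigzag_map_snoc p comp_assoc del: comp_apply o_apply)
  qed
qed (simp add: path_iff)

lemma linear_weight: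
  assumes "\<rho> \<in> paths"
  shows "linear_on sc sc (stalk C (fst (hd \<rho>))) (stalk C (snd (last \<rho>))) (weight \<rho>)"
proof -
  have "linear_on sc sc (stalk C (fst (hd \<rho>))) (stalk C (snd (last \<rho>)))
      (\<lambda>v. sc (of_int (path_sign ori \<rho>)) (zigzag_map C \<rho> v))"
    using assms matched(2)[OF path_end_in(3)[OF assms]]
    by (intro linear_on_scale vs.vector_space_axioms subspace_stalk linear_zigzag)
  then show ?thesis
    by (simp add: path_weight_def[abs_def])
qed

lemma weight_mem: "\<rho> \<in> paths \<Longrightarrow> v \<in> stalk C (fst (hd \<rho>)) \<Longrightarrow> weight \<rho> v \<in> stalk C (snd (last \<rho>))"
  using linear_weight unfolding linear_on_def by blast

lemma weight_zero: "\<rho> \<in> paths \<Longrightarrow> weight \<rho> 0 = 0"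
  using linear_on_zero[OF vs.vector_space_axioms subspace_stalk linear_weight]
    matched(1) path_end_in(2) by blast

lemma face_map_scale:
  assumes "\<sigma> \<in> K" "\<tau> \<in> K" "\<tau> \<subseteq> \<sigma>" "v \<in> stalk C \<sigma>"
  shows "face_map \<sigma> \<tau> (sc c v) = sc (of_int (inc \<sigma> \<tau>) * c) (ext C \<sigma> \<tau> v)"
  using linear_ext[OF assms(1-3)] assms(4) by (simp add: face_map_def linear_on_def)

text \<open>
  The incidence number occurs twice, once in the weight of a path and once in the face map, and
  cancels because its square is one.
\<close>

lemma face_map_stalk_inv:
  assumes p: "p \<in> \<Sigma>" and v: "v \<in> stalk C (fst p)"
  shows "face_map (snd p) (fst p) (sc (of_int (inc (snd p) (fst p)) * c) (stalk_inv C (snd p) (fst p) v)) = sc c v"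
proof -
  note m = matched[OF p]
  have "stalk_inv C (snd p) (fst p) v \<in> stalk C (snd p)"
    using linear_stalk_inv[OF p] v by (simp add: linear_on_def)
  moreover have "ext C (snd p) (fst p) (stalk_inv C (snd p) (fst p) v) = v"
    unfolding stalk_inv_def using m(4) v by (metis bij_betw_imp_surj_on f_inv_into_f)
  moreover have "of_int (inc (snd p) (fst p)) * of_int (inc (snd p) (fst p)) = (1 :: 'f)"
    using incidence_square[OF m(2,1,3)] by (metis of_int_1 of_int_mult)
  then have "of_int (inc (snd p) (fst p)) * (of_int (inc (snd p) (fst p)) * c) = c"
    by (simp flip: mult.assoc)
  ultimately show ?thesis
    using m by (simp add: face_map_scale codim_one_face_def)
qed

lemma face_map_weight_singleton:
  assumes "p \<in> \<Sigma>" "v \<in> stalk C (fst p)"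
  shows "face_map (snd p) (fst p) (weight [p] v) = - v"
  using face_map_stalk_inv[OF assms, of "- 1"] assms(1)
  by (cases p) (simp add: path_weight_def path_sign_def)

text \<open>
  The sign \<open>(-1)\<^sup>m\<close> in the weight of a path makes this the cancellation that turns the sum over
  all paths into an inverse: following a path by the face map to the source of \<open>p\<close> gives the
  negative of following its extension by \<open>p\<close> in the same way.
\<close>

lemma face_map_weight_snoc:
  assumes path: "\<rho> @ [p] \<in> paths" and ne: "\<rho> \<noteq> []" and v: "v \<in> stalk C (fst (hd \<rho>))"
  shows "face_map (snd p) (fst p) (weight (\<rho> @ [p]) v) = - face_map (snd (last \<rho>)) (fst p) (weight \<rho> v)"
proof -
  note D = path_snocD[OF path ne]
  note m = matched[OF D(2)]
  obtain \<sigma> \<tau> where p: "p = (\<sigma>, \<tau>)" by (cases p)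
  let ?\<tau>' = "snd (last \<rho>)"
  have \<tau>': "?\<tau>' \<in> K" "fst p \<subseteq> ?\<tau>'"
    using D(3) matched(2)[OF path_end_in(3)[OF D(1)]] by (auto simp: codim_one_face_def)
  have z: "zigzag_map C \<rho> v \<in> stalk C ?\<tau>'"
    using linear_zigzag[OF D(1)] v by (simp add: linear_on_def)
  then have e: "ext C ?\<tau>' (fst p) (zigzag_map C \<rho> v) \<in> stalk C (fst p)"
    using linear_ext[OF \<tau>'(1) m(1) \<tau>'(2)] by (simp add: linear_on_def)
  let ?c = "- (of_int (inc ?\<tau>' (fst p)) * of_int (path_sign ori \<rho>)) :: 'f"
  have "weight (\<rho> @ [p]) v =
      sc (of_int (inc (snd p) (fst p)) * ?c) (stalk_inv C (snd p) (fst p) (ext C ?\<tau>' (fst p) (zigzag_map C \<rho> v)))"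
    using ne by (simp add: path_weight_def p zigzag_map_snoc path_sign_snoc mult.assoc)
  also have "face_map (snd p) (fst p) \<dots> = sc ?c (ext C ?\<tau>' (fst p) (zigzag_map C \<rho> v))"
    by (rule face_map_stalk_inv[OF D(2) e])
  also have "\<dots> = - face_map ?\<tau>' (fst p) (weight \<rho> v)"
    using face_map_scale[OF \<tau>'(1) m(1) \<tau>'(2) z] by (simp add: path_weight_def)
  finally show ?thesis .
qed

section \<open>Inverting the boundary map from targets to sources\<close>

text \<open>
  The sum of the weights of all paths, as an operator from chains to chains of one degree higher.
  It reads only the components at sources and has values on targets.
\<close>

definition flow :: "('a set \<Rightarrow> 'v) \<Rightarrow> 'a set \<Rightarrow> 'v" where
  "flow u \<tau> = (\<Sum>\<rho>\<in>{\<rho>\<in>paths. snd (last \<rho>) = \<tau>}. weight \<rho> (u (fst (hd \<rho>))))"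

lemma flow_nontarget: "\<tau> \<notin> snd ` \<Sigma> \<Longrightarrow> flow u \<tau> = 0"
  unfolding flow_def using path_end_in(3) by (intro sum.neutral) auto

lemma flow_chain:
  assumes u: "u \<in> Ch k"
  shows "flow u \<in> Ch (k + 1)"
proof -
  have "flow u \<tau> \<in> stalk C \<tau>" if "\<tau> \<in> K" for \<tau>
    unfolding flow_def using matched(1)[OF path_end_in(2)] chain_mem[OF u] weight_mem
    by (intro vs.subspace_sum[OF subspace_stalk[OF that]]) auto
  moreover have "flow u \<tau> = 0" if "\<tau> \<notin> simplices K (k + 1)" for \<tau>
    unfolding flow_def
  proof (intro sum.neutral ballI)
    fix \<rho> assume "\<rho> \<in> {\<rho> \<in> paths. snd (last \<rho>) = \<tau>}"
    then have \<rho>: "\<rho> \<in> paths" and \<tau>: "snd (last \<rho>) = \<tau>" by auto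
    have "\<tau> \<in> K" using matched(2)[OF path_end_in(3)[OF \<rho>]] \<tau> by simp
    then have "fst (hd \<rho>) \<notin> simplices K k"
      using that path_card[OF \<rho>] \<tau> by (auto simp: simplices_def)
    then have "u (fst (hd \<rho>)) = 0"
      using u by (simp add: chains_eq stalk_sum_def)
    then show "weight \<rho> (u (fst (hd \<rho>))) = 0"
      using weight_zero \<rho> by simp
  qed
  ultimately show ?thesis
    by (auto simp: chains_eq stalk_sum_def simplices_def)
qed

text \<open>
  Sorting the paths by their last target turns the sum over targets into a sum over all paths;
  paths whose last target has the wrong dimension to have \<open>\<omega>\<close> as a facet contribute zero.
\<close>

lemma boundary_flow:
  assumes u: "u \<in> Ch k" and \<omega>: "\<omega> \<in> simplices K k"
  shows "d (k + 1) (flow u) \<omega> =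
    (\<Sum>\<rho>\<in>paths. face_map (snd (last \<rho>)) \<omega> (weight \<rho> (u (fst (hd \<rho>)))))"
proof -
  let ?F = "\<lambda>\<rho>. face_map (snd (last \<rho>)) \<omega> (weight \<rho> (u (fst (hd \<rho>))))"
  let ?P = "\<lambda>\<tau>. {\<rho> \<in> paths. snd (last \<rho>) = \<tau>}"
  have \<omega>K: "\<omega> \<in> K" using \<omega> by (simp add: simplices_def)
  have "face_map \<tau> \<omega> (flow u \<tau>) = sum ?F (?P \<tau>)" if "\<tau> \<in> K" for \<tau>
    unfolding flow_def using that \<omega>K weight_mem matched(1)[OF path_end_in(2)] chain_mem[OF u]
    by (subst face_map_sum) auto
  then have "d (k + 1) (flow u) \<omega> = (\<Sum>\<tau>\<in>simplices K (k + 1). sum ?F (?P \<tau>))"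
    using \<omega> by (simp add: boundary_eq simplices_def)
  also have "\<dots> = (\<Sum>\<tau>\<in>K. sum ?F (?P \<tau>))"
  proof (rule sum.mono_neutral_left[OF finite_complex])
    show "\<forall>\<tau>\<in>K - simplices K (k + 1). sum ?F (?P \<tau>) = 0"
      using \<omega> by (auto simp: simplices_def codim_one_face_def intro!: sum.neutral face_map_nonface)
  qed (auto simp: simplices_def)
  also have "\<dots> = sum ?F paths"
    using matched(2)[OF path_end_in(3)]
    by (intro sum.group finite_paths finite_complex) auto
  finally show ?thesis .
qed

text \<open>
  Flowing is minus a right inverse of the boundary map from targets to sources. Among the paths
  after which the source of \<open>p\<close> can be reached, those that end with \<open>p\<close> are \<open>[p]\<close> and the
  extensions by \<open>p\<close> of those that do not. The extensions cancel against the paths that they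
  extend, and only \<open>[p]\<close> remains.
\<close>

lemma boundary_flow_source:
  assumes u: "u \<in> Ch k" and p: "p \<in> \<Sigma>" and src: "fst p \<in> simplices K k"
  shows "d (k + 1) (flow u) (fst p) = - u (fst p)"
proof -
  let ?F = "\<lambda>\<rho>. face_map (snd (last \<rho>)) (fst p) (weight \<rho> (u (fst (hd \<rho>))))"
  define B where "B = {\<rho> \<in> paths. last \<rho> \<noteq> p \<and> fst p \<lhd>\<^sub>1 snd (last \<rho>)}"
  let ?A = "insert [p] ((\<lambda>\<rho>. \<rho> @ [p]) ` B)"
  have mem: "u (fst (hd \<rho>)) \<in> stalk C (fst (hd \<rho>))" if "\<rho> \<in> paths" for \<rho>
    using matched(1)[OF path_end_in(2)[OF that]] chain_mem[OF u] by blast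
  have B: "\<rho> \<in> paths" "\<rho> \<noteq> []" "\<rho> @ [p] \<in> paths" if "\<rho> \<in> B" for \<rho>
    using that path_snoc[of \<rho> p] p by (auto simp: B_def path_iff)
  have finB: "finite B" using finite_paths by (simp add: B_def)
  have A: "?A = {\<rho> \<in> paths. last \<rho> = p}"
  proof (intro equalityI subsetI)
    fix \<rho> assume "\<rho> \<in> ?A"
    then show "\<rho> \<in> {\<rho> \<in> paths. last \<rho> = p}"
      using B(3) path_singleton[OF p] by auto
  next
    fix \<rho> assume "\<rho> \<in> {\<rho> \<in> paths. last \<rho> = p}"
    then have \<rho>: "\<rho> \<in> paths" "last \<rho> = p" by auto
    define \<rho>' where "\<rho>' = butlast \<rho>"
    have eq: "\<rho> = \<rho>' @ [p]"
      using \<rho> path_end_in(1) by (simp add: \<rho>'_def flip: \<rho>(2))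
    show "\<rho> \<in> ?A"
    proof (cases "\<rho>' = []")
      case False
      then have "\<rho>' \<in> B"
        using path_snocD[of \<rho>' p] \<rho>(1) eq by (auto simp: B_def)
      then show ?thesis using eq by blast
    qed (simp add: eq)
  qed
  have "d (k + 1) (flow u) (fst p) = sum ?F paths"
    using boundary_flow[OF u src] .
  also have "\<dots> = sum ?F (?A \<union> B)"
  proof (rule sum.mono_neutral_right[OF finite_paths])
    show "?A \<union> B \<subseteq> paths" unfolding A by (auto simp: B_def)
    show "\<forall>\<rho>\<in>paths - (?A \<union> B). ?F \<rho> = 0"
      unfolding A using matched(2)[OF path_end_in(3)] matched(1)[OF p]
      by (auto simp: B_def intro!: face_map_nonface)
  qed
  also have "\<dots> = sum ?F ?A + sum ?F B"
    using finB by (intro sum.union_disjoint) (auto simp: A finite_paths, auto simp: B_def)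
  also have "sum ?F ?A = ?F [p] + sum ?F ((\<lambda>\<rho>. \<rho> @ [p]) ` B)"
    using finB B(2) by (intro sum.insert) auto
  also have "sum ?F ((\<lambda>\<rho>. \<rho> @ [p]) ` B) = (\<Sum>\<rho>\<in>B. ?F (\<rho> @ [p]))"
    by (subst sum.reindex) (auto simp: inj_on_def)
  also have "\<dots> = (\<Sum>\<rho>\<in>B. - ?F \<rho>)"
    using B mem face_map_weight_snoc by (intro sum.cong refl) simp
  also have "?F [p] = - u (fst p)"
    using face_map_weight_singleton[OF p] mem[OF path_singleton[OF p]] by simp
  finally show ?thesis
    by (simp add: sum_negf)
qed

text \<open>
  The boundary map from targets to sources is injective: among the paths whose first target
  carries a nonzero component of \<open>t\<close>, a longest one could be prolonged at the front, since the
  component of the boundary at its first source has to be cancelled by another target.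
\<close>

lemma target_chain_eq_zero:
  assumes t: "t \<in> Ch k" and targets: "\<And>\<tau>. \<tau> \<notin> snd ` \<Sigma> \<Longrightarrow> t \<tau> = 0"
    and sources: "\<And>\<sigma>. \<sigma> \<in> fst ` \<Sigma> \<Longrightarrow> d k t \<sigma> = 0"
  shows "t = 0"
proof (rule ccontr)
  assume "t \<noteq> 0"
  then obtain \<tau> where "t \<tau> \<noteq> 0" by fastforce
  then have "\<tau> \<in> snd ` \<Sigma>"
    using targets by metis
  with \<open>t \<tau> \<noteq> 0\<close> obtain p where "p \<in> \<Sigma>" "t (snd p) \<noteq> 0"
    by auto
  define Q where "Q = {\<rho> \<in> paths. t (snd (hd \<rho>)) \<noteq> 0}"
  have "[p] \<in> Q"
    using \<open>p \<in> \<Sigma>\<close> \<open>t (snd p) \<noteq> 0\<close> path_singleton by (simp add: Q_def)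
  moreover have "finite Q"
    using finite_paths by (simp add: Q_def)
  ultimately obtain \<rho> where \<rho>: "\<rho> \<in> Q" and longest: "\<And>\<rho>'. \<rho>' \<in> Q \<Longrightarrow> length \<rho>' \<le> length \<rho>"
    using Max_in[of "length ` Q"] Max_ge[of "length ` Q"]
    by (metis (no_types, lifting) empty_iff finite_imageI image_iff imageI)
  define q where "q = hd \<rho>"
  have path: "\<rho> \<in> paths" and q: "q \<in> \<Sigma>" "t (snd q) \<noteq> 0"
    using \<rho> path_end_in(2) by (auto simp: Q_def q_def)
  note m = matched[OF q(1)]
  have snd_q: "snd q \<in> simplices K k"
    using q t by (auto simp: chains_eq stalk_sum_def)
  then have fst_q: "fst q \<in> simplices K (k - 1)"
    using m by (auto simp: simplices_def codim_one_face_def)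
  have unmatched: "face_map \<tau> (fst q) (t \<tau>) = 0" if \<tau>: "\<tau> \<in> simplices K k - {snd q}" for \<tau>
  proof (rule ccontr)
    assume nz: "face_map \<tau> (fst q) (t \<tau>) \<noteq> 0"
    have "\<tau> \<in> K" using \<tau> by (simp add: simplices_def)
    then have "t \<tau> \<noteq> 0" "fst q \<lhd>\<^sub>1 \<tau>"
      using nz face_map_zero face_map_nonface m(1) by force+
    have "\<tau> \<in> snd ` \<Sigma>"
      using \<open>t \<tau> \<noteq> 0\<close> targets by metis
    then obtain r where r: "r \<in> \<Sigma>" "\<tau> = snd r"
      by auto
    then have "r # \<rho> \<in> paths"
      using \<open>fst q \<lhd>\<^sub>1 \<tau>\<close> \<tau> by (intro path_cons[OF path]) (auto simp: q_def)
    then have "r # \<rho> \<in> Q"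
      using \<open>t \<tau> \<noteq> 0\<close> r by (simp add: Q_def)
    then show False using longest by fastforce
  qed
  have "0 = d k t (fst q)"
    using sources q by simp
  also have "\<dots> = (\<Sum>\<tau>\<in>simplices K k. face_map \<tau> (fst q) (t \<tau>))"
    using fst_q by (simp add: boundary_eq)
  also have "\<dots> = face_map (snd q) (fst q) (t (snd q))"
    using unmatched finite_simplices snd_q by (simp add: sum.remove[of _ "snd q"])
  finally have "sc (of_int (inc (snd q) (fst q))) (ext C (snd q) (fst q) (t (snd q))) = 0"
    by (simp add: face_map_def)
  moreover have "of_int (inc (snd q) (fst q)) \<noteq> (0 :: 'f)"
    using incidence_square[OF m(2,1,3)] by (metis mult_zero_left of_int_1 of_int_mult zero_neq_one)
  ultimately have "ext C (snd q) (fst q) (t (snd q)) = 0"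
    by simp
  moreover have "ext C (snd q) (fst q) 0 = 0"
    using linear_on_zero[OF vs.vector_space_axioms subspace_stalk linear_ext] m
    by (auto simp: codim_one_face_def)
  ultimately have "t (snd q) = 0"
    using bij_betw_imp_inj_on[OF m(4)] chain_mem[OF t m(2)] vs.subspace_0[OF subspace_stalk[OF m(2)]]
    by (metis inj_onD)
  then show False using q by simp
qed

end

section \<open>The Morse complex as the complex of reduced chains\<close>

context acyclic_cosheaf_matching
begin

abbreviation Morse :: "('f, 'a set \<Rightarrow> 'v) cpx" where "Morse \<equiv> morse_complex ori K C \<Sigma>"

abbreviation scf :: "'f \<Rightarrow> ('a set \<Rightarrow> 'v) \<Rightarrow> ('a set \<Rightarrow> 'v)" where
  "scf \<equiv> \<lambda>c x \<sigma>. sc c (x \<sigma>)"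

lemma morse_chains: "chains Morse k = stalk_sum C (critical K \<Sigma> \<inter> simplices K k)"
  and scl_morse: "scl Morse = scf"
  by (simp_all add: morse_complex_def)

lemma subspace_morse: "fam.subspace (chains Morse k)"
  unfolding morse_chains by (rule subspace_stalk_sum) (auto simp: simplices_def)

lemma morse_chain: "x \<in> chains Morse k \<Longrightarrow> x \<in> Ch k"
  using vs.subspace_0[OF subspace_stalk]
  by (auto simp: morse_chains chains_eq stalk_sum_def simplices_def)

lemma critical_iff: "\<alpha> \<in> critical K \<Sigma> \<longleftrightarrow> \<alpha> \<in> K \<and> \<alpha> \<notin> fst ` \<Sigma> \<and> \<alpha> \<notin> snd ` \<Sigma>"
  by (force simp: critical_def)

definition critical_part :: "('a set \<Rightarrow> 'v) \<Rightarrow> 'a set \<Rightarrow> 'v" where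
  "critical_part y \<sigma> = (if \<sigma> \<in> critical K \<Sigma> then y \<sigma> else 0)"

lemma linear_critical_part: "linear_on scf scf (Ch k) (chains Morse k) critical_part"
  by (auto simp: linear_on_def morse_chains chains_eq stalk_sum_def critical_part_def)

lemma boundary_add: "x \<in> Ch k \<Longrightarrow> y \<in> Ch k \<Longrightarrow> d k (x + y) = d k x + d k y"
  using linear_boundary[of k] by (simp add: linear_on_def)

lemma boundary_zero: "d k 0 = 0"
  using linear_on_zero[OF fam.vector_space_axioms subspace_chains linear_boundary] .

lemma boundary_mem: "x \<in> Ch k \<Longrightarrow> d k x \<in> Ch (k - 1)"
  using linear_boundary[of k] by (simp add: linear_on_def)

text \<open>
  The model of the Morse complex inside the simplicial chain complex. The condition on the
  boundary makes it a subcomplex and fixes the components at targets.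
\<close>

definition reduced :: "int \<Rightarrow> ('a set \<Rightarrow> 'v) set" where
  "reduced k = {y \<in> Ch k. \<forall>\<sigma>\<in>fst ` \<Sigma>. y \<sigma> = 0 \<and> d k y \<sigma> = 0}"

lemma reducedI:
  "y \<in> Ch k \<Longrightarrow> (\<And>p. p \<in> \<Sigma> \<Longrightarrow> y (fst p) = 0) \<Longrightarrow> (\<And>p. p \<in> \<Sigma> \<Longrightarrow> d k y (fst p) = 0) \<Longrightarrow> y \<in> reduced k"
  by (auto simp: reduced_def)

lemma reducedD:
  assumes "y \<in> reduced k"
  shows "y \<in> Ch k" "p \<in> \<Sigma> \<Longrightarrow> y (fst p) = 0" "p \<in> \<Sigma> \<Longrightarrow> d k y (fst p) = 0"
  using assms by (auto simp: reduced_def)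

lemma subspace_reduced: "fam.subspace (reduced k)"
  unfolding fam.subspace_def
proof (intro conjI ballI allI)
  show "0 \<in> reduced k"
    using fam.subspace_0[OF subspace_chains] by (intro reducedI) (simp_all add: boundary_zero)
  fix x assume x: "x \<in> reduced k"
  show "scf c x \<in> reduced k" for c
  proof (rule reducedI)
    show "scf c x \<in> Ch k"
      using reducedD(1)[OF x] by (rule fam.subspace_scale[OF subspace_chains])
    have "d k (scf c x) = scf c (d k x)"
      using linear_boundary[of k] reducedD(1)[OF x] by (simp add: linear_on_def)
    then show "d k (scf c x) (fst p) = 0" if "p \<in> \<Sigma>" for p
      using reducedD(3)[OF x that] by simp
  qed (use reducedD(2)[OF x] in simp)
  fix y assume y: "y \<in> reduced k"
  show "x + y \<in> reduced k"
    using reducedD[OF x] reducedD[OF y] fam.subspace_add[OF subspace_chains]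
    by (intro reducedI) (simp_all add: boundary_add)
qed

lemma boundary_reduced: "y \<in> reduced k \<Longrightarrow> d k y \<in> reduced (k - 1)"
  using reducedD[of y k] by (intro reducedI) (simp_all add: boundary_mem boundary_boundary)

lemma reduced_eqI:
  assumes x: "x \<in> reduced k" and y: "y \<in> reduced k" and eq: "critical_part x = critical_part y"
  shows "x = y"
proof -
  have diff: "x - y \<in> reduced k"
    using x y by (rule fam.subspace_diff[OF subspace_reduced])
  have "x - y = 0"
  proof (rule target_chain_eq_zero)
    show "x - y \<in> Ch k"
      by (rule reducedD(1)[OF diff])
    show "d k (x - y) \<sigma> = 0" if "\<sigma> \<in> fst ` \<Sigma>" for \<sigma>
      using reducedD(3)[OF diff] that by auto
    show "(x - y) \<tau> = 0" if \<tau>: "\<tau> \<notin> snd ` \<Sigma>" for \<tau>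
    proof -
      consider "\<tau> \<in> critical K \<Sigma>" | "\<tau> \<in> fst ` \<Sigma>" | "\<tau> \<notin> K"
        using \<tau> by (auto simp: critical_iff)
      then show ?thesis
      proof cases
        case 1
        with fun_cong[OF eq, of \<tau>] show ?thesis by (simp add: critical_part_def)
      next
        case 2
        then show ?thesis using reducedD(2)[OF diff] by auto
      next
        case 3
        then have "\<tau> \<notin> simplices K k" by (simp add: simplices_def)
        with reducedD(1)[OF diff] show ?thesis by (simp add: chains_eq stalk_sum_def)
      qed
    qed
  qed
  then show ?thesis by simp
qed

text \<open>
  The reduced extension of a critical chain: the flow has values on targets, so the critical part
  is unchanged, and it is chosen to remove the boundary at the sources.
\<close>

definition embed :: "int \<Rightarrow> ('a set \<Rightarrow> 'v) \<Rightarrow> 'a set \<Rightarrow> 'v" where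
  "embed k x = x + flow (d k x)"

lemma flow_boundary_mem: "x \<in> Ch k \<Longrightarrow> flow (d k x) \<in> Ch k"
  using flow_chain[OF boundary_mem, of x k] by simp

lemma flow_source: "p \<in> \<Sigma> \<Longrightarrow> flow u (fst p) = 0"
  using matched_distinct[of p] by (intro flow_nontarget) (metis image_iff)

text \<open>
  Adding the boundary of its flow removes all source components of a chain. This serves both to
  extend critical chains and to move arbitrary cycles into the reduced chains.
\<close>

lemma add_boundary_flow_source:
  assumes u: "u \<in> Ch k" and p: "p \<in> \<Sigma>"
  shows "(u + d (k + 1) (flow u)) (fst p) = 0"
proof (cases "fst p \<in> simplices K k")
  case True
  then show ?thesis using boundary_flow_source[OF u p] by simp
next
  case False
  then show ?thesis using u by (simp add: chains_eq stalk_sum_def boundary_eq)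
qed

lemma embed_reduced:
  assumes x: "x \<in> chains Morse k"
  shows "embed k x \<in> reduced k"
proof (rule reducedI)
  note xC = morse_chain[OF x]
  show "embed k x \<in> Ch k"
    unfolding embed_def using xC flow_boundary_mem[OF xC] by (rule fam.subspace_add[OF subspace_chains])
  fix p assume p: "p \<in> \<Sigma>"
  have "x (fst p) = 0"
    using x p by (auto simp: morse_chains stalk_sum_def critical_iff)
  then show "embed k x (fst p) = 0"
    using flow_source[OF p] by (simp add: embed_def)
  have "d k (embed k x) = d k x + d k (flow (d k x))"
    unfolding embed_def using xC flow_boundary_mem[OF xC] by (rule boundary_add)
  then show "d k (embed k x) (fst p) = 0"
    using add_boundary_flow_source[OF boundary_mem[OF xC] p] by simp
qed

lemma critical_part_embed:
  assumes "x \<in> chains Morse k"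
  shows "critical_part (embed k x) = x"
proof
  fix \<sigma>
  show "critical_part (embed k x) \<sigma> = x \<sigma>"
    using assms flow_nontarget[of \<sigma> "d k x"]
    by (auto simp: critical_part_def embed_def critical_iff morse_chains stalk_sum_def)
qed

lemma critical_part_mem: "y \<in> Ch k \<Longrightarrow> critical_part y \<in> chains Morse k"
  using linear_critical_part[of k] by (simp add: linear_on_def)

lemma embed_critical_part:
  assumes y: "y \<in> reduced k"
  shows "embed k (critical_part y) = y"
proof -
  have x: "critical_part y \<in> chains Morse k"
    using reducedD(1)[OF y] by (rule critical_part_mem)
  show ?thesis
    using embed_reduced[OF x] y critical_part_embed[OF x] by (rule reduced_eqI)
qed

text \<open>
  Reduced chains form a subspace, so sums and multiples of reduced extensions are the reduced
  extensions of sums and multiples.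
\<close>

lemma linear_embed: "linear_on scf scf (chains Morse k) (Ch k) (embed k)"
  unfolding linear_on_def
proof (intro conjI ballI allI)
  fix x assume x: "x \<in> chains Morse k"
  note ex = embed_reduced[OF x]
  show "embed k x \<in> Ch k"
    by (rule reducedD(1)[OF ex])
  note lin = linear_critical_part[of k, unfolded linear_on_def]
  show "embed k (scf c x) = scf c (embed k x)" for c
  proof -
    have "scf c (embed k x) \<in> reduced k"
      using ex by (rule fam.subspace_scale[OF subspace_reduced])
    moreover have "critical_part (scf c (embed k x)) = scf c x"
      using lin reducedD(1)[OF ex] by (simp add: critical_part_embed[OF x])
    ultimately show ?thesis
      using embed_critical_part by metis
  qed
  fix y assume y: "y \<in> chains Morse k"
  note ey = embed_reduced[OF y]
  have "embed k x + embed k y \<in> reduced k"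
    using ex ey by (rule fam.subspace_add[OF subspace_reduced])
  moreover have "critical_part (embed k x + embed k y) = x + y"
    using lin reducedD(1)[OF ex] reducedD(1)[OF ey]
    by (simp add: critical_part_embed[OF x] critical_part_embed[OF y])
  ultimately show "embed k (x + y) = embed k x + embed k y"
    using embed_critical_part by metis
qed

lemma morse_term:
  assumes \<rho>: "\<rho> \<in> paths" and "\<alpha> \<in> K" "\<omega> \<in> K" and v: "v \<in> stalk C \<alpha>"
  shows "sc (of_int (inc (snd (last \<rho>)) \<omega> * inc \<alpha> (fst (hd \<rho>))))
      (ext C (snd (last \<rho>)) \<omega> (weight \<rho> (ext C \<alpha> (fst (hd \<rho>)) v)))
    = face_map (snd (last \<rho>)) \<omega> (weight \<rho> (face_map \<alpha> (fst (hd \<rho>)) v))"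
proof (cases "fst (hd \<rho>) \<lhd>\<^sub>1 \<alpha> \<and> \<omega> \<lhd>\<^sub>1 snd (last \<rho>)")
  case True
  let ?\<sigma> = "fst (hd \<rho>)" and ?\<tau> = "snd (last \<rho>)"
  have K: "?\<sigma> \<in> K" "?\<tau> \<in> K"
    using path_end_simplices[OF \<rho>] .
  have sub: "?\<sigma> \<subseteq> \<alpha>" "\<omega> \<subseteq> ?\<tau>"
    using True by (auto simp: codim_one_face_def)
  have e: "ext C \<alpha> ?\<sigma> v \<in> stalk C ?\<sigma>"
    using linear_ext[OF assms(2) K(1) sub(1)] v by (simp add: linear_on_def)
  have "weight \<rho> (sc c (ext C \<alpha> ?\<sigma> v)) = sc c (weight \<rho> (ext C \<alpha> ?\<sigma> v))" for c
    using linear_weight[OF \<rho>] e by (simp add: linear_on_def)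
  then show ?thesis
    using face_map_scale[OF K(2) assms(3) sub(2) weight_mem[OF \<rho> e]]
    by (simp add: face_map_def[of \<alpha>])
next
  case False
  have K: "fst (hd \<rho>) \<in> K" "snd (last \<rho>) \<in> K"
    using path_end_simplices[OF \<rho>] .
  then have "inc \<alpha> (fst (hd \<rho>)) = 0 \<or> inc (snd (last \<rho>)) \<omega> = 0"
    using False incidence_nonzero_iff assms(2,3) by blast
  then show ?thesis
    using face_map_zero[OF K(2) assms(3)] weight_zero[OF \<rho>] by (auto simp: face_map_def)
qed

text \<open>
  The sum over paths in the Morse boundary map is what the boundary of the flow of \<open>\<partial> x\<close>
  contributes at a critical simplex. For a reduced extension the boundary is again reduced, so its
  critical part determines it.
\<close>

lemma morse_boundary:
  assumes x: "x \<in> chains Morse k"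
  shows "bdry Morse k x = critical_part (d k (embed k x))"
proof
  fix \<omega>
  note xC = morse_chain[OF x]
  let ?X = "critical K \<Sigma> \<inter> simplices K k"
  show "bdry Morse k x \<omega> = critical_part (d k (embed k x)) \<omega>"
  proof (cases "\<omega> \<in> critical K \<Sigma> \<inter> simplices K (k - 1)")
    case True
    then have \<omega>: "\<omega> \<in> simplices K (k - 1)" "\<omega> \<in> K"
      by (auto simp: simplices_def)
    have X: "\<alpha> \<in> K" "x \<alpha> \<in> stalk C \<alpha>" if "\<alpha> \<in> ?X" for \<alpha>
      using that chain_mem[OF xC] by (auto simp: simplices_def)
    have finX: "finite ?X" using finite_simplices by simp
    have sum_X: "(\<Sum>\<alpha>\<in>simplices K k. face_map \<alpha> \<sigma> (x \<alpha>)) = (\<Sum>\<alpha>\<in>?X. face_map \<alpha> \<sigma> (x \<alpha>))"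
      if "\<sigma> \<in> K" for \<sigma>
    proof (rule sum.mono_neutral_right[OF finite_simplices])
      show "\<forall>\<alpha>\<in>simplices K k - ?X. face_map \<alpha> \<sigma> (x \<alpha>) = 0"
        using x that by (auto simp: morse_chains stalk_sum_def simplices_def face_map_zero)
    qed simp
    have dx: "d k x \<sigma> = (\<Sum>\<alpha>\<in>?X. face_map \<alpha> \<sigma> (x \<alpha>))" if \<sigma>: "\<sigma> \<in> K" for \<sigma>
    proof (cases "\<sigma> \<in> simplices K (k - 1)")
      case True
      then show ?thesis using sum_X[OF \<sigma>] by (simp add: boundary_eq)
    next
      case False
      then have "(\<Sum>\<alpha>\<in>?X. face_map \<alpha> \<sigma> (x \<alpha>)) = 0"
        using \<sigma> by (intro sum.neutral ballI face_map_nonface)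
          (auto simp: simplices_def codim_one_face_def)
      with False show ?thesis by (simp add: boundary_eq)
    qed
    have path: "face_map (snd (last \<rho>)) \<omega> (weight \<rho> (d k x (fst (hd \<rho>)))) =
        (\<Sum>\<alpha>\<in>?X. face_map (snd (last \<rho>)) \<omega> (weight \<rho> (face_map \<alpha> (fst (hd \<rho>)) (x \<alpha>))))"
      if \<rho>: "\<rho> \<in> paths" for \<rho>
    proof -
      have K: "fst (hd \<rho>) \<in> K" "snd (last \<rho>) \<in> K"
        using path_end_simplices[OF \<rho>] .
      have mem: "face_map \<alpha> (fst (hd \<rho>)) (x \<alpha>) \<in> stalk C (fst (hd \<rho>))" if "\<alpha> \<in> ?X" for \<alpha>
        using X[OF that] K by (intro face_map_mem)
      have "weight \<rho> (d k x (fst (hd \<rho>))) = (\<Sum>\<alpha>\<in>?X. weight \<rho> (face_map \<alpha> (fst (hd \<rho>)) (x \<alpha>)))"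
        unfolding dx[OF K(1)]
        using linear_on_sum[OF vs.vector_space_axioms subspace_stalk[OF K(1)] linear_weight[OF \<rho>] mem] .
      then show ?thesis
        using face_map_sum[OF K(2) \<omega>(2) weight_mem[OF \<rho> mem], of ?X] by simp
    qed
    have "bdry Morse k x \<omega> = (\<Sum>\<alpha>\<in>?X. morse_block ori C \<Sigma> \<alpha> \<omega> (x \<alpha>))"
      using True by (simp add: morse_complex_def block_map_def)
    also have "\<dots> = (\<Sum>\<alpha>\<in>?X. face_map \<alpha> \<omega> (x \<alpha>) + (\<Sum>\<rho>\<in>paths.
        face_map (snd (last \<rho>)) \<omega> (weight \<rho> (face_map \<alpha> (fst (hd \<rho>)) (x \<alpha>)))))"
      using X \<omega>(2) unfolding morse_block_def
      by (intro sum.cong refl arg_cong2[where f = "(+)"] morse_term) (auto simp: face_map_def)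
    also have "\<dots> = (\<Sum>\<alpha>\<in>?X. face_map \<alpha> \<omega> (x \<alpha>)) + (\<Sum>\<rho>\<in>paths. \<Sum>\<alpha>\<in>?X.
        face_map (snd (last \<rho>)) \<omega> (weight \<rho> (face_map \<alpha> (fst (hd \<rho>)) (x \<alpha>))))"
      unfolding sum.distrib by (rule arg_cong[OF sum.swap])
    also have "\<dots> = d k x \<omega> + (\<Sum>\<rho>\<in>paths. face_map (snd (last \<rho>)) \<omega> (weight \<rho> (d k x (fst (hd \<rho>)))))"
      using path dx[OF \<omega>(2)] by simp
    also have "\<dots> = d k x \<omega> + d k (flow (d k x)) \<omega>"
      using boundary_flow[OF boundary_mem[OF xC] \<omega>(1)] by simp
    also have "\<dots> = critical_part (d k (embed k x)) \<omega>"
      using True boundary_add[OF xC flow_boundary_mem[OF xC]] by (simp add: critical_part_def embed_def)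
    finally show ?thesis .
  qed (auto simp: morse_complex_def block_map_def critical_part_def boundary_eq)
qed

lemma embed_morse_boundary:
  "x \<in> chains Morse k \<Longrightarrow> embed (k - 1) (bdry Morse k x) = d k (embed k x)"
  by (simp add: morse_boundary embed_critical_part boundary_reduced embed_reduced)

lemma linear_morse_boundary: "linear_on scf scf (chains Morse k) (chains Morse (k - 1)) (bdry Morse k)"
proof (rule linear_on_cong)
  show "linear_on scf scf (chains Morse k) (chains Morse (k - 1)) (critical_part \<circ> (d k \<circ> embed k))"
    by (intro linear_on_comp[OF linear_on_comp[OF linear_embed linear_boundary] linear_critical_part])
qed (simp_all add: subspace_morse fam.vector_space_axioms morse_boundary)

lemma chain_complex_morse: "chain_complex Morse"
  unfolding chain_complex_def scl_morse
proof (intro conjI allI ballI)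
  fix k x assume x: "x \<in> chains Morse k"
  then have bx: "bdry Morse k x \<in> chains Morse (k - 1)"
    using linear_morse_boundary by (simp add: linear_on_def)
  have "bdry Morse (k - 1) (bdry Morse k x) = critical_part (d (k - 1) (d k (embed k x)))"
    by (simp add: morse_boundary[OF bx] embed_morse_boundary[OF x])
  also have "\<dots> = 0"
    using boundary_boundary[OF reducedD(1)[OF embed_reduced[OF x]]] by (auto simp: critical_part_def)
  finally show "bdry Morse (k - 1) (bdry Morse k x) = 0" .
qed (simp_all add: fam.vector_space_axioms subspace_morse linear_morse_boundary)

text \<open>
  Both halves correct a chain by the boundary of its flow. A cycle becomes a reduced cycle in the
  same class. If a reduced cycle is the boundary of \<open>w\<close>, the correction of \<open>w\<close> has the same
  boundary, so it is reduced too, and its critical part bounds in the Morse complex.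
\<close>

lemma quasi_isomorphism_embed: "quasi_isomorphism Morse (simplicial_chains ori K C) embed"
proof -
  let ?D = "simplicial_chains ori K C"
  have map: "chain_map Morse ?D embed"
    unfolding chain_map_def scl_morse scl_chains
    using linear_embed embed_morse_boundary by simp
  show ?thesis
    unfolding quasi_isomorphism_iff[OF chain_complex_morse chain_complex_simplicial map]
  proof (intro allI conjI ballI impI)
    fix k x assume x: "x \<in> cycles Morse k" and "embed k x \<in> boundaries ?D k"
    then obtain w where w: "w \<in> Ch (k + 1)" and bw: "embed k x = d (k + 1) w"
      by (auto simp: boundaries_def)
    have xM: "x \<in> chains Morse k" using x by (simp add: cycles_def)
    let ?t = "flow w"
    let ?w' = "w + d (k + 2) ?t"
    have t: "?t \<in> Ch (k + 2)"
      using flow_chain[OF w] by (simp add: add.assoc)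
    have dt: "d (k + 2) ?t \<in> Ch (k + 1)"
      using boundary_mem[OF t] by (simp add: algebra_simps)
    have dw': "d (k + 1) ?w' = embed k x"
      using boundary_add[OF w dt] boundary_boundary[OF t] bw by (simp add: algebra_simps)
    have w': "?w' \<in> reduced (k + 1)"
    proof (rule reducedI)
      show "?w' \<in> Ch (k + 1)"
        using w dt by (rule fam.subspace_add[OF subspace_chains])
      show "?w' (fst p) = 0" if "p \<in> \<Sigma>" for p
        using add_boundary_flow_source[OF w that] by (simp add: add.assoc)
      show "d (k + 1) ?w' (fst p) = 0" if "p \<in> \<Sigma>" for p
        unfolding dw' using reducedD(2)[OF embed_reduced[OF xM] that] .
    qed
    let ?y = "critical_part ?w'"
    have y: "?y \<in> chains Morse (k + 1)"
      using reducedD(1)[OF w'] by (rule critical_part_mem)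
    have "bdry Morse (k + 1) ?y = x"
      using morse_boundary[OF y] embed_critical_part[OF w'] dw' critical_part_embed[OF xM] by simp
    then show "x \<in> boundaries Morse k"
      using y unfolding boundaries_def by blast
  next
    fix k z assume z: "z \<in> cycles ?D k"
    then have zC: "z \<in> Ch k" and dz: "d k z = 0"
      by (simp_all add: cycles_def)
    let ?z' = "z + d (k + 1) (flow z)"
    note t = flow_chain[OF zC]
    have dt: "d (k + 1) (flow z) \<in> Ch k"
      using boundary_mem[OF t] by simp
    have dz': "d k ?z' = 0"
      using boundary_add[OF zC dt] boundary_boundary[OF t] dz by simp
    have z': "?z' \<in> reduced k"
    proof (rule reducedI)
      show "?z' \<in> Ch k"
        using zC dt by (rule fam.subspace_add[OF subspace_chains])
    qed (use add_boundary_flow_source[OF zC] dz' in simp_all)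
    let ?x = "critical_part ?z'"
    have x: "?x \<in> chains Morse k"
      using reducedD(1)[OF z'] by (rule critical_part_mem)
    have "bdry Morse k ?x = 0"
      using morse_boundary[OF x] embed_critical_part[OF z'] dz' by (auto simp: critical_part_def)
    moreover have "embed k ?x - z \<in> boundaries ?D k"
      using embed_critical_part[OF z'] t by (simp add: boundaries_def)
    ultimately show "\<exists>x\<in>cycles Morse k. embed k x - z \<in> boundaries ?D k"
      using x by (intro bexI[of _ ?x]) (simp_all add: cycles_def)
  qed
qed

end

section \<open>Compatible subcomplexes\<close>

lemma restricted_matching:
  assumes big: "acyclic_cosheaf_matching K ori C \<Sigma>" and N: "subcomplex N K"
  shows "acyclic_cosheaf_matching N ori C (restrict_matching \<Sigma> N)"
proof -
  interpret acyclic_cosheaf_matching K ori C \<Sigma> by fact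
  have sub: "N \<subseteq> K" and R: "restrict_matching \<Sigma> N \<subseteq> \<Sigma>"
    using N by (auto simp: subcomplex_def restrict_matching_def)
  show ?thesis
  proof
    show "simplicial_complex N"
      using N by (simp add: subcomplex_def)
    have N_K: "\<sigma> \<in> K" if "\<sigma> \<in> N" for \<sigma>
      using sub that by (rule subsetD)
    show "local_orientation N ori"
      unfolding local_orientation_def
    proof (intro conjI ballI impI)
      fix \<sigma> \<tau> assume "\<sigma> \<in> N" "\<tau> \<in> N" "\<tau> \<subseteq> \<sigma>"
      then show "ori \<tau> = filter (\<lambda>v. v \<in> \<tau>) (ori \<sigma>)"
        using orientation[unfolded local_orientation_def, THEN conjunct2, rule_format] N_K by blast
    qed (simp_all add: N_K orientation_distinct orientation_set)
    show "cosheaf N C"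
      unfolding cosheaf_def
      by (intro conjI ballI allI impI) (use cosheaf N_K in \<open>simp_all add: cosheaf_def\<close>)
    show "acyclic_matching N (restrict_matching \<Sigma> N)"
      unfolding acyclic_matching_def
    proof
      show "partial_matching N (restrict_matching \<Sigma> N)"
        unfolding partial_matching_def
      proof (intro conjI ballI impI)
        fix p assume p: "p \<in> restrict_matching \<Sigma> N"
        then show "case p of (\<sigma>, \<tau>) \<Rightarrow> \<sigma> \<in> N \<and> \<tau> \<in> N \<and> \<sigma> \<lhd>\<^sub>1 \<tau>"
          using matched(3)[of p] by (auto simp: restrict_matching_def)
        fix q assume "q \<in> restrict_matching \<Sigma> N" "p \<noteq> q"
        then show "{fst p, snd p} \<inter> {fst q, snd q} = {}"
          using matched_disjoint[of p q] p R by blast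
      qed
      have "matching_paths (restrict_matching \<Sigma> N) \<subseteq> matching_paths \<Sigma>"
        using R by (auto simp: matching_paths_def)
      then show "\<forall>\<rho>\<in>matching_paths (restrict_matching \<Sigma> N). gradient_path \<rho>"
        using acyclic by (auto simp: acyclic_matching_def)
    qed
    show "cosheaf_compatible C (restrict_matching \<Sigma> N)"
      using compatible R by (auto simp: cosheaf_compatible_def)
  qed
qed

locale matching_compatible_subcomplex = acyclic_cosheaf_matching K ori C \<Sigma>
  for K :: "'a set set" and ori and C :: "('f::field, 'a, 'v::ab_group_add) cosheaf_data" and \<Sigma> +
  fixes N :: "'a set set"
  assumes subcomplex: "subcomplex N K"
    and N_compatible: "subcomplex_compatible N \<Sigma>"
begin

sublocale sub: acyclic_cosheaf_matching N ori C "restrict_matching \<Sigma> N"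
  using acyclic_cosheaf_matching_axioms subcomplex by (rule restricted_matching)

lemma N_subset: "N \<subseteq> K"
  using subcomplex by (simp add: subcomplex_def)

lemma critical_restrict: "critical N (restrict_matching \<Sigma> N) = critical K \<Sigma> \<inter> N"
  using N_compatible N_subset
  by (fastforce simp: critical_def restrict_matching_def subcomplex_compatible_def)

lemma critical_simplices_restrict:
  "critical N (restrict_matching \<Sigma> N) \<inter> simplices N k = critical K \<Sigma> \<inter> simplices K k \<inter> N"
  unfolding critical_restrict using N_subset by (auto simp: simplices_def)

lemma sub_chain:
  assumes "x \<in> sub.Ch k"
  shows "x \<in> Ch k" "\<sigma> \<notin> N \<Longrightarrow> x \<sigma> = 0"
  using assms vs.subspace_0[OF subspace_stalk] N_subset
  by (auto simp: chains_eq sub.chains_eq stalk_sum_def simplices_def)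

text \<open>
  A subcomplex contains the faces of its simplices, so the boundary of a chain supported on it
  has no component outside.
\<close>

lemma boundary_restrict:
  assumes x: "x \<in> sub.Ch k"
  shows "sub.d k x = d k x"
proof
  fix \<tau>
  note xK = sub_chain(1)[OF x]
  have zero: "face_map \<sigma> \<tau> (x \<sigma>) = 0" if "\<sigma> \<in> K" "\<tau> \<in> K" "\<sigma> \<notin> N \<or> \<tau> \<notin> N" for \<sigma>
  proof (cases "\<sigma> \<in> N")
    case True
    then have "\<not> \<tau> \<lhd>\<^sub>1 \<sigma>"
      using that sub.face_closed[of \<sigma> \<tau>] simplex_nonempty[of \<tau>] by (auto simp: codim_one_face_def)
    with that show ?thesis by (simp add: face_map_nonface)
  next
    case False
    with that show ?thesis by (simp add: sub_chain(2)[OF x] face_map_zero)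
  qed
  show "sub.d k x \<tau> = d k x \<tau>"
  proof (cases "\<tau> \<in> simplices K (k - 1)")
    case True
    then have \<tau>: "\<tau> \<in> K" by (simp add: simplices_def)
    show ?thesis
    proof (cases "\<tau> \<in> N")
      case True
      have "(\<Sum>\<sigma>\<in>simplices N k. face_map \<sigma> \<tau> (x \<sigma>)) = (\<Sum>\<sigma>\<in>simplices K k. face_map \<sigma> \<tau> (x \<sigma>))"
        using N_subset zero \<tau>
        by (intro sum.mono_neutral_left finite_simplices) (auto simp: simplices_def)
      then show ?thesis
        using True \<open>\<tau> \<in> simplices K (k - 1)\<close>
        by (simp add: boundary_eq sub.boundary_eq simplices_def)
    next
      case False
      then have "(\<Sum>\<sigma>\<in>simplices K k. face_map \<sigma> \<tau> (x \<sigma>)) = 0"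
        using zero \<tau> by (intro sum.neutral) (auto simp: simplices_def)
      then show ?thesis
        using False by (simp add: boundary_eq sub.boundary_eq simplices_def)
    qed
  next
    case False
    then show ?thesis
      using N_subset by (auto simp: boundary_eq sub.boundary_eq simplices_def)
  qed
qed

text \<open>
  By compatibility a source in \<open>N\<close> is a source of the restricted matching; at sources outside
  \<open>N\<close> both the chain and its boundary vanish.
\<close>

lemma reduced_restrict:
  assumes y: "y \<in> sub.reduced k"
  shows "y \<in> reduced k"
proof (rule reducedI)
  note yN = sub.reducedD(1)[OF y]
  show "y \<in> Ch k"
    by (rule sub_chain(1)[OF yN])
  fix p assume p: "p \<in> \<Sigma>"
  have dy: "d k y = sub.d k y" "sub.d k y \<in> sub.Ch (k - 1)"
    using boundary_restrict[OF yN] sub.boundary_mem[OF yN] by simp_all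
  have "y (fst p) = 0 \<and> d k y (fst p) = 0"
  proof (cases "fst p \<in> N")
    case True
    then have "p \<in> restrict_matching \<Sigma> N"
      using p N_compatible by (auto simp: restrict_matching_def subcomplex_compatible_def)
    then show ?thesis
      using sub.reducedD(2,3)[OF y] dy by simp
  next
    case False
    then show ?thesis
      using sub_chain(2)[OF yN] sub_chain(2)[OF dy(2)] dy(1) by simp
  qed
  then show "y (fst p) = 0" "d k y (fst p) = 0" by simp_all
qed

lemma critical_part_restrict: "x \<in> sub.Ch k \<Longrightarrow> sub.critical_part x = critical_part x"
  using sub_chain(2)[of x k]
  by (auto simp: fun_eq_iff critical_part_def sub.critical_part_def critical_restrict)

text \<open>
  Both sides are reduced chains of \<open>K\<close> with critical part \<open>x\<close>, so uniqueness of reduced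
  extensions identifies them without a comparison of the two sets of paths.
\<close>

lemma embed_restrict:
  assumes x: "x \<in> chains sub.Morse k"
  shows "sub.embed k x = embed k x"
proof -
  note e = sub.embed_reduced[OF x]
  have "critical_part (sub.embed k x) = x"
    using critical_part_restrict[OF sub.reducedD(1)[OF e]] sub.critical_part_embed[OF x] by simp
  then show ?thesis
    using embed_critical_part[OF reduced_restrict[OF e]] by simp
qed

lemma morse_chain_restrict: "x \<in> chains sub.Morse k \<Longrightarrow> x \<in> chains Morse k"
  using sub.morse_chain[of x k, THEN sub_chain(1)]
  by (auto simp: morse_chains sub.morse_chains critical_simplices_restrict stalk_sum_def chains_eq)

lemma morse_boundary_restrict:
  assumes x: "x \<in> chains sub.Morse k"
  shows "bdry sub.Morse k x = bdry Morse k x"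
proof -
  note e = sub.reducedD(1)[OF sub.embed_reduced[OF x]]
  have "bdry sub.Morse k x = critical_part (sub.d k (sub.embed k x))"
    using sub.morse_boundary[OF x] critical_part_restrict[OF sub.boundary_mem[OF e]] by simp
  also have "\<dots> = bdry Morse k x"
    using boundary_restrict[OF e] embed_restrict[OF x] morse_boundary[OF morse_chain_restrict[OF x]]
    by simp
  finally show ?thesis .
qed

end

section \<open>The two Mayer-Vietoris sequences\<close>

text \<open>
  Exactness depends only on the sets of simplices over which the stalks are summed. With
  \<open>X k\<close> and \<open>Y k\<close> the simplices of dimension \<open>k\<close> in the two subcomplexes this is the
  Mayer-Vietoris sequence; with their critical simplices it is the Morse version.
\<close>

lemma short_exact_stalk_sums:
  fixes C :: "('f::field, 'a, 'v::ab_group_add) cosheaf_data"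
    and A B D E :: "('f, 'a set \<Rightarrow> 'v) cpx"
  assumes cpx: "chain_complex A" "chain_complex B" "chain_complex D" "chain_complex E"
    and scl: "scl A = scl E" "scl B = scl E" "scl D = scl E" "scl E = (\<lambda>c x \<sigma>. vscale C c (x \<sigma>))"
    and chains: "\<And>k. chains A k = stalk_sum C (X k \<inter> Y k)" "\<And>k. chains B k = stalk_sum C (X k)"
      "\<And>k. chains D k = stalk_sum C (Y k)" "\<And>k. chains E k = stalk_sum C (X k \<union> Y k)"
    and bdry: "\<And>k x. x \<in> chains A k \<Longrightarrow> bdry A k x = bdry E k x"
      "\<And>k x. x \<in> chains B k \<Longrightarrow> bdry B k x = bdry E k x"
      "\<And>k x. x \<in> chains D k \<Longrightarrow> bdry D k x = bdry E k x"
  shows "short_exact \<lparr> lcpx = A, lmap = (\<lambda>k x. (x, x)), mcpx = B \<oplus>\<^sub>c D,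
    rmap = (\<lambda>k (x, y). x - y), rcpx = E \<rparr>"
proof -
  interpret vector_space "scl E"
    using cpx by (simp add: chain_complex_def)
  have sub: "subspace (chains E k)" for k
    using cpx(4) by (simp add: chain_complex_def)
  have zero: "0 \<in> stalk C \<sigma>" if "\<sigma> \<in> X k \<union> Y k" for \<sigma> k
    using subspace_0[OF sub[of k]] that by (auto simp: chains stalk_sum_def)
  have incl: "chains A k = chains B k \<inter> chains D k" "chains B k \<subseteq> chains E k" "chains D k \<subseteq> chains E k" for k
    using zero[of _ k] by (auto simp: chains stalk_sum_def)
  have lin: "linear_on (scl E) (scl E) (chains E k) (chains E (k - 1)) (bdry E k)" for k
    using cpx(4) by (simp add: chain_complex_def)
  have bdiff: "bdry E k (x - y) = bdry E k x - bdry E k y" if "x \<in> chains E k" "y \<in> chains E k" for k x y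
    using linear_on_diff[OF vector_space_axioms vector_space_axioms sub lin that] .
  have diag: "chain_map A (B \<oplus>\<^sub>c D) (\<lambda>k x. (x, x))"
    using bdry incl(1) by (auto simp: chain_map_def linear_on_def cpx_sum_def scl)
  have minus: "chain_map (B \<oplus>\<^sub>c D) E (\<lambda>k (x, y). x - y)"
    using bdry bdiff incl(2,3) subspace_diff[OF sub]
    by (auto simp: chain_map_def linear_on_def cpx_sum_def scl(1-3) scale_right_diff_distrib subset_iff)
  have exact: "(\<lambda>x. (x, x)) ` chains A k = {y \<in> chains (B \<oplus>\<^sub>c D) k. (case y of (x, y) \<Rightarrow> x - y) = 0}" for k
    unfolding incl(1) by (auto simp: cpx_sum_def)
  have onto: "(\<lambda>(x, y). x - y) ` chains (B \<oplus>\<^sub>c D) k = chains E k" for k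
  proof (intro equalityI subsetI)
    fix z assume "z \<in> (\<lambda>(x, y). x - y) ` chains (B \<oplus>\<^sub>c D) k"
    then show "z \<in> chains E k"
      using incl(2,3)[of k] by (auto simp: cpx_sum_def intro!: subspace_diff[OF sub])
  next
    fix z assume z: "z \<in> chains E k"
    \<comment> \<open>The part of \<open>z\<close> over \<open>X k\<close> goes to the first summand, and the rest, negated, to the second.\<close>
    define x where "x = (\<lambda>\<sigma>. if \<sigma> \<in> X k then z \<sigma> else 0)"
    have x: "x \<in> chains B k"
      using z by (auto simp: x_def chains stalk_sum_def)
    then have "x - z \<in> chains E k"
      using z incl(2) by (intro subspace_diff[OF sub]) auto
    then have "x - z \<in> chains D k"
      using z by (auto simp: x_def chains stalk_sum_def)
    with x have "(x, x - z) \<in> chains (B \<oplus>\<^sub>c D) k"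
      by (simp add: cpx_sum_def)
    moreover have "z = (case (x, x - z) of (x, y) \<Rightarrow> x - y)" by simp
    ultimately show "z \<in> (\<lambda>(x, y). x - y) ` chains (B \<oplus>\<^sub>c D) k"
      by (rule rev_image_eqI)
  qed
  show ?thesis
    unfolding short_exact_def
    using cpx chain_complex_cpx_sum[OF cpx(2,3)] diag minus exact onto by (simp add: inj_on_def)
qed

theorem theorem7p2:
  fixes K L M :: "'a set set"
    and ori :: "'a set \<Rightarrow> 'a list"
    and C :: "('f::field, 'a, 'v::ab_group_add) cosheaf_data"
    and \<Sigma> :: "('a set \<times> 'a set) set"
    and Morse :: "'a set set \<Rightarrow> ('f, 'a set \<Rightarrow> 'v) cpx"
  assumes "simplicial_complex K"
    and "local_orientation K ori"
    and "cosheaf K C"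
    and "subcomplex L K" and "subcomplex M K" and "K = L \<union> M"
    and "acyclic_matching K \<Sigma>"
    and "cosheaf_compatible C \<Sigma>"
    and "subcomplex_compatible L \<Sigma>" and "subcomplex_compatible M \<Sigma>"
    and Morse_def: "\<And>N. Morse N = morse_complex ori N C (restrict_matching \<Sigma> N)"
  shows "\<exists>p q. let S = \<lparr> lcpx = Morse (L \<inter> M), lmap = p, mcpx = Morse L \<oplus>\<^sub>c Morse M,
                         rmap = q, rcpx = Morse K \<rparr>
               in short_exact S \<and> quasi_isomorphic_ses S (mayer_vietoris ori L M C)"
proof -
  interpret K: acyclic_cosheaf_matching K ori C \<Sigma>
    using assms by unfold_locales
  have I: "subcomplex (L \<inter> M) K"
    using assms(4,5) by (auto simp: subcomplex_def simplicial_complex_def)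
  have I_comp: "subcomplex_compatible (L \<inter> M) \<Sigma>"
    using assms(9,10) by (fastforce simp: subcomplex_compatible_def)
  interpret I: matching_compatible_subcomplex K ori C \<Sigma> "L \<inter> M"
    using I I_comp by unfold_locales
  interpret L: matching_compatible_subcomplex K ori C \<Sigma> L
    using assms by unfold_locales
  interpret M: matching_compatible_subcomplex K ori C \<Sigma> M
    using assms by unfold_locales
  have "restrict_matching \<Sigma> K = \<Sigma>"
    using K.matched(1,2) by (fastforce simp: restrict_matching_def)
  then have MK: "Morse K = K.Morse"
    by (simp add: Morse_def)
  have simplices_split: "simplices K k = simplices L k \<union> simplices M k"
    "simplices (L \<inter> M) k = simplices L k \<inter> simplices M k" for k
    using assms(6) by (auto simp: simplices_def)
  let ?p = "\<lambda>k x. (x, x)" and ?q = "\<lambda>k (x, y). x - y"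
  let ?S = "\<lparr> lcpx = Morse (L \<inter> M), lmap = ?p, mcpx = Morse L \<oplus>\<^sub>c Morse M, rmap = ?q, rcpx = Morse K \<rparr>"
  let ?T = "mayer_vietoris ori L M C"
  have S: "short_exact ?S"
    unfolding Morse_def[of L] Morse_def[of M] Morse_def[of "L \<inter> M"] MK
  proof (rule short_exact_stalk_sums[where C = C])
    show "chains I.sub.Morse k = stalk_sum C ((critical K \<Sigma> \<inter> simplices K k \<inter> L) \<inter> (critical K \<Sigma> \<inter> simplices K k \<inter> M))" for k
      unfolding I.sub.morse_chains I.critical_simplices_restrict by (rule arg_cong[where f = "stalk_sum C"]) auto
    show "chains K.Morse k = stalk_sum C ((critical K \<Sigma> \<inter> simplices K k \<inter> L) \<union> (critical K \<Sigma> \<inter> simplices K k \<inter> M))" for k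
      unfolding K.morse_chains using assms(6) by (intro arg_cong[where f = "stalk_sum C"]) (auto simp: simplices_def)
  qed (simp_all add: I.sub.chain_complex_morse L.sub.chain_complex_morse M.sub.chain_complex_morse
      K.chain_complex_morse I.sub.scl_morse L.sub.scl_morse M.sub.scl_morse K.scl_morse
      L.sub.morse_chains L.critical_simplices_restrict M.sub.morse_chains M.critical_simplices_restrict
      I.morse_boundary_restrict
      L.morse_boundary_restrict[unfolded L.sub.morse_chains L.critical_simplices_restrict]
      M.morse_boundary_restrict[unfolded M.sub.morse_chains M.critical_simplices_restrict])
  have T: "short_exact ?T"
    unfolding mayer_vietoris_def assms(6)[symmetric]
  proof (rule short_exact_stalk_sums[where C = C])
    show "chains (simplicial_chains ori (L \<inter> M) C) k = stalk_sum C (simplices L k \<inter> simplices M k)" for k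
      by (simp add: I.sub.chains_eq simplices_split)
    show "chains (simplicial_chains ori K C) k = stalk_sum C (simplices L k \<union> simplices M k)" for k
      by (simp add: K.chains_eq simplices_split)
  qed (simp_all add: I.sub.chain_complex_simplicial L.sub.chain_complex_simplicial
      M.sub.chain_complex_simplicial K.chain_complex_simplicial I.sub.scl_chains L.sub.scl_chains
      M.sub.scl_chains K.scl_chains L.sub.chains_eq M.sub.chains_eq
      I.boundary_restrict L.boundary_restrict[unfolded L.sub.chains_eq]
      M.boundary_restrict[unfolded M.sub.chains_eq])
  have chains_I: "x \<in> chains I.sub.Morse k \<Longrightarrow> x \<in> chains L.sub.Morse k \<and> x \<in> chains M.sub.Morse k" for x k
    using S unfolding short_exact_def chain_map_def linear_on_def Morse_def by (simp add: cpx_sum_def)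
  have "quasi_iso_ladder ?S ?T I.sub.embed (\<lambda>k (x, y). (L.sub.embed k x, M.sub.embed k y)) K.embed"
    unfolding quasi_iso_ladder_def Morse_def[of L] Morse_def[of M] Morse_def[of "L \<inter> M"] MK
      mayer_vietoris_def assms(6)[symmetric]
  proof (simp, intro conjI allI ballI)
    show "quasi_isomorphism I.sub.Morse (simplicial_chains ori (L \<inter> M) C) I.sub.embed"
      by (rule I.sub.quasi_isomorphism_embed)
    show "quasi_isomorphism K.Morse (simplicial_chains ori K C) K.embed"
      by (rule K.quasi_isomorphism_embed)
    show "quasi_isomorphism (L.sub.Morse \<oplus>\<^sub>c M.sub.Morse)
        (simplicial_chains ori L C \<oplus>\<^sub>c simplicial_chains ori M C)
        (\<lambda>k (x, y). (L.sub.embed k x, M.sub.embed k y))"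
      by (intro quasi_isomorphism_cpx_sum L.sub.chain_complex_morse M.sub.chain_complex_morse
          L.sub.chain_complex_simplicial M.sub.chain_complex_simplicial
          L.sub.quasi_isomorphism_embed M.sub.quasi_isomorphism_embed)
    fix k
    show "L.sub.embed k x = I.sub.embed k x" "M.sub.embed k x = I.sub.embed k x"
      if "x \<in> chains I.sub.Morse k" for x
      using that chains_I[OF that] by (simp_all add: I.embed_restrict L.embed_restrict M.embed_restrict)
    fix y assume "y \<in> chains (L.sub.Morse \<oplus>\<^sub>c M.sub.Morse) k"
    then obtain a b where y: "y = (a, b)" "a \<in> chains L.sub.Morse k" "b \<in> chains M.sub.Morse k"
      by (auto simp: cpx_sum_def)
    then have "K.embed k (a - b) = K.embed k a - K.embed k b"
      by (intro linear_on_diff[OF K.fam.vector_space_axioms K.fam.vector_space_axioms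
            K.subspace_morse K.linear_embed] L.morse_chain_restrict M.morse_chain_restrict)
    then show "K.embed k (case y of (x, y) \<Rightarrow> x - y) =
        (case case y of (x, y) \<Rightarrow> (L.sub.embed k x, M.sub.embed k y) of (x, y) \<Rightarrow> x - y)"
      using y by (simp add: L.embed_restrict M.embed_restrict)
  qed
  then show ?thesis
    using S T unfolding quasi_isomorphic_ses_def Let_def by blast
qed

end
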